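(* Let $\beta$ be a real number with $0<\beta$ sufficiently small compared with $1/(20\cdot 17^3)$, and let $n$ be a sufficiently large integer. Let $G$ be a graph on $n$ vertices with $\delta(G)\ge (n+1)/2$. If there exists a partition $V_1\cup V_2$ of $V(G)$ such that $|V_1|\ge (1/2-7\beta)n$ and $\Delta(G[V_1])\le \beta n$, then $G$ contains a spanning Halin subgraph.
   Context: $\Delta(G[V_1])$ is the maximum degree of the subgraph induced by $V_1$. A homeomorphically irreducible tree (HIT) is a tree with no vertex of degree 2. A Halin graph is obtained from a HIT with at least 4 vertices embedded in the plane by connecting its leaves into a cycle following the cyclic order determined by the embedding. A spanning Halin subgraph of $G$ is a Halin subgraph of $G$ with vertex set $V(G)$. *)

theory Defs
  imports Complex_Main "Graph_Theory.Graph_Theory" "HOL-Combinatorics.Orbits"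
begin

text \<open>
  Finite simple graphs are the symmetric, loop-free digraphs of the locale \<^locale>\<open>pair_graph\<close>:
  an edge \<open>uv\<close> is the pair of arcs \<open>(u, v)\<close>, \<open>(v, u)\<close>, so the degree of \<open>v\<close> is \<^const>\<open>out_degree\<close>.
\<close>

definition min_degree :: "('a, 'b) pre_digraph \<Rightarrow> nat" where
  "min_degree G = Min (out_degree G ` verts G)"

definition max_degree :: "('a, 'b) pre_digraph \<Rightarrow> nat" where
  "max_degree G = Max (out_degree G ` verts G)"

definition neighbours :: "'a pair_pre_digraph \<Rightarrow> 'a \<Rightarrow> 'a set" where
  "neighbours G v = {w. (v, w) \<in> parcs G}"

text \<open>
  The library's \<^const>\<open>tree\<close> does not fit here: in a symmetric digraph each edge already forms a
  directed cycle of length two. A cycle of the undirected graph is a cycle of length at least three.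
\<close>

definition undirected_tree :: "'a pair_pre_digraph \<Rightarrow> bool" where
  "undirected_tree T \<longleftrightarrow> pair_graph T \<and> connected (with_proj T) \<and>
    \<not> (\<exists>p. pre_digraph.cycle (with_proj T) p \<and> length p \<ge> 3)"

definition homeomorphically_irreducible_tree :: "'a pair_pre_digraph \<Rightarrow> bool" where
  "homeomorphically_irreducible_tree T \<longleftrightarrow>
    undirected_tree T \<and> (\<forall>v \<in> pverts T. out_degree (with_proj T) v \<noteq> 2)"

definition leaves :: "'a pair_pre_digraph \<Rightarrow> 'a set" where
  "leaves T = {v \<in> pverts T. out_degree (with_proj T) v = 1}"

text \<open>
  An embedding in the plane is represented by its rotation system: \<open>\<rho> v\<close> sends each neighbour of
  \<open>v\<close> to the next one in, say, the clockwise order around \<open>v\<close>. In general a rotation system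
  describes an embedding in some orientable surface, but for a tree this surface is always the
  sphere, so rotation systems of a tree correspond to its embeddings in the plane.
\<close>

definition rotation_system :: "'a pair_pre_digraph \<Rightarrow> ('a \<Rightarrow> 'a \<Rightarrow> 'a) \<Rightarrow> bool" where
  "rotation_system T \<rho> \<longleftrightarrow>
    (\<forall>v \<in> pverts T. neighbours T v \<noteq> {} \<longrightarrow> cyclic_on (\<rho> v) (neighbours T v))"

text \<open>
  One step of the walk along the boundary of a face. An embedded tree has a single face, and its
  boundary walk traverses each arc once.
\<close>

definition face_step :: "('a \<Rightarrow> 'a \<Rightarrow> 'a) \<Rightarrow> 'a \<times> 'a \<Rightarrow> 'a \<times> 'a" where
  "face_step \<rho> = (\<lambda>(u, v). (v, \<rho> v u))"

text \<open>
  The cyclic order of the leaves is the order in which the boundary walk visits them: \<open>w\<close> succeeds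
  \<open>u\<close> if \<open>w\<close> is the first leaf that the walk reaches after it has left \<open>u\<close>.
\<close>

definition next_leaf :: "'a pair_pre_digraph \<Rightarrow> ('a \<Rightarrow> 'a \<Rightarrow> 'a) \<Rightarrow> 'a \<Rightarrow> 'a \<Rightarrow> bool" where
  "next_leaf T \<rho> u w \<longleftrightarrow> u \<in> leaves T \<and> w \<in> leaves T \<and>
    (\<exists>v k. (u, v) \<in> parcs T \<and> snd ((face_step \<rho> ^^ k) (u, v)) = w \<and>
      (\<forall>j<k. snd ((face_step \<rho> ^^ j) (u, v)) \<notin> leaves T))"

definition add_leaf_cycle :: "'a pair_pre_digraph \<Rightarrow> ('a \<Rightarrow> 'a \<Rightarrow> 'a) \<Rightarrow> 'a pair_pre_digraph" where
  "add_leaf_cycle T \<rho> = \<lparr> pverts = pverts T,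
     parcs = parcs T \<union> {(u, w). next_leaf T \<rho> u w \<or> next_leaf T \<rho> w u} \<rparr>"

definition halin_graph :: "'a pair_pre_digraph \<Rightarrow> bool" where
  "halin_graph H \<longleftrightarrow> (\<exists>T \<rho>. homeomorphically_irreducible_tree T \<and> card (pverts T) \<ge> 4 \<and>
     rotation_system T \<rho> \<and> H = add_leaf_cycle T \<rho>)"

end

theory Submission
  imports Defs
begin

text \<open>
  \<open>G\<close> is almost a balanced complete bipartite graph with sides \<open>A\<close> and \<open>B\<close>; after moving a few
  exceptional vertices every vertex has linearly many neighbours on the other side. A perfect
  matching between \<open>A\<close> and \<open>B\<close> whose edges \<open>(a, b)\<close>, \<open>(a', b')\<close> are joined when \<open>a b'\<close> and \<open>a' b\<close>
  are edges of \<open>G\<close> has a Hamilton path, which is a ladder in \<open>G\<close>: one rail is the spine of a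
  caterpillar and the other rail consists of its leaves. The ladder becomes a Halin graph when a
  spine vertex at either end gets two adjacent leaves. Each such pair of leaves uses an edge inside
  \<open>A\<close> or \<open>B\<close> and shifts the balance of the sides by one, so if \<open>d = |B| - |A| > 0\<close>, then \<open>d + 1\<close>
  disjoint edges inside \<open>B\<close> are needed; the minimum degree condition provides them, except that for
  \<open>d = 1\<close> the edges inside both sides may be stars, in which case \<open>G\<close> contains a spanning wheel.
\<close>

section \<open>Matchings and Hamilton paths by exchange arguments\<close>

text \<open>The obstacle is the exceptional vertices. Their cross degrees are linear in n but far
  below the half that a Dirac-type condition demands. Since they are few, both the matching and the
  Hamilton path are taken as configurations of least cost, in which a defect can always be repaired
  by one exchange. The rung graph adds a loss of its own: a rung needs two cross edges at once to
  reach another, so a rung of two exceptional vertices could be isolated. Hence the matching gives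
  every rung a typical endpoint.

  The spine changes parts at every rung, so the number of rungs decides in which part it ends; there
  must be a way to flip this parity that keeps the balance.

  The count d + 1 arises as follows. Each of d edges inside B absorbs one unit of the surplus, the
  first of them at the starting end. The closing end needs one more edge and would absorb one unit
  too many; moreover its leaf has to meet the first leaf by a cross edge. Both defects are cured by
  one spine vertex with leaves on both sides, which moves the two ends of the leaf path to
  A.\<close>

lemma bijection_by_swaps:
  fixes R :: "'a \<Rightarrow> 'b \<Rightarrow> bool"
  assumes fin: "finite A" "finite B" "card A = card B" "finite EA" "finite EB"
    and A_good: "\<And>a. a \<in> A \<Longrightarrow> a \<notin> EA \<Longrightarrow> card {b \<in> B. \<not> R a b} \<le> k"
    and B_good: "\<And>b. b \<in> B \<Longrightarrow> b \<notin> EB \<Longrightarrow> card {a \<in> A. \<not> R a b} \<le> k"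
    and A_deg: "\<And>a. a \<in> A \<Longrightarrow> k + card EA < card {b \<in> B. R a b}"
    and B_deg: "\<And>b. b \<in> B \<Longrightarrow> k < card {a \<in> A. R a b}"
  shows "\<exists>f. bij_betw f A B \<and> (\<forall>a \<in> A. R a (f a))"
proof -
  \<comment> \<open>The weight 2 makes it profitable to trade a bad pair of two exceptional elements for a bad pair
    with at most one, so that minimality of the cost also excludes the former.\<close>
  define w :: "'a \<Rightarrow> 'b \<Rightarrow> nat" where
    "w a b = (if R a b then 0 else if a \<in> EA \<and> b \<in> EB then 2 else 1)" for a b
  define cost where "cost f = (\<Sum>a \<in> A. w a (f a))" for f
  obtain f0 where "bij_betw f0 A B"
    using fin finite_same_card_bij by blast
  then obtain f where f: "bij_betw f A B" and min: "\<And>g. bij_betw g A B \<Longrightarrow> cost f \<le> cost g"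
    using ex_has_least_nat[of "\<lambda>f. bij_betw f A B" f0 cost] by blast
  have "R a (f a)" if a: "a \<in> A" for a
  proof (rule ccontr)
    assume bad: "\<not> R a (f a)"
    define b where "b = f a"
    have b: "b \<in> B" using a f by (auto simp: b_def bij_betw_def)
    have img: "card {i \<in> A. P (f i)} = card {y \<in> B. P y}" for P
      using f by (intro bij_betw_same_card[of f]) (auto simp: bij_betw_def inj_on_def)
    \<comment> \<open>Exchanging the partners of \<open>a\<close> and \<open>i\<close> creates the
      pairs on the left. If \<open>a\<close> or \<open>b\<close> is typical, at most
      \<open>k\<close> choices of \<open>i\<close> spoil its new pair, fewer than there are good
      choices for the other one, so both new pairs can be good. If both are exceptional, an
      \<open>i\<close> outside \<open>EA\<close> brings the cost 2 down to at most 1. Only this case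
      counts \<open>EA\<close>, which explains the asymmetry of the degree bounds.\<close>
    have "\<exists>i \<in> A. i \<noteq> a \<and> w a (f i) + w i b < w a b + w i (f i)"
    proof -
      consider "a \<notin> EA" | "b \<notin> EB" | "a \<in> EA" "b \<in> EB" by blast
      then show ?thesis
      proof cases
        case 1
        have "card {i \<in> A. \<not> R a (f i)} < card {i \<in> A. R i b}"
          using A_good[OF a 1] B_deg[OF b] img[of "\<lambda>y. \<not> R a y"] by simp
        then have "\<not> {i \<in> A. R i b} \<subseteq> {i \<in> A. \<not> R a (f i)}"
          using card_mono[of "{i \<in> A. \<not> R a (f i)}" "{i \<in> A. R i b}"] fin by auto
        then obtain i where "i \<in> A" "R i b" "R a (f i)" by blast
        then show ?thesis using bad by (intro bexI[of _ i]) (auto simp: w_def b_def)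
      next
        case 2
        have "card {i \<in> A. \<not> R i b} < card {i \<in> A. R a (f i)}"
          using B_good[OF b 2] A_deg[OF a] img[of "\<lambda>y. R a y"] by simp
        then have "\<not> {i \<in> A. R a (f i)} \<subseteq> {i \<in> A. \<not> R i b}"
          using card_mono[of "{i \<in> A. \<not> R i b}" "{i \<in> A. R a (f i)}"] fin by auto
        then obtain i where "i \<in> A" "R i b" "R a (f i)" by blast
        then show ?thesis using bad by (intro bexI[of _ i]) (auto simp: w_def b_def)
      next
        case 3
        have "card EA < card {i \<in> A. R a (f i)}"
          using A_deg[OF a] img[of "\<lambda>y. R a y"] by simp
        then have "\<not> {i \<in> A. R a (f i)} \<subseteq> EA"
          using card_mono[of EA "{i \<in> A. R a (f i)}"] fin by auto
        then obtain i where "i \<in> A" "R a (f i)" "i \<notin> EA" by blast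
        then show ?thesis using bad 3 by (intro bexI[of _ i]) (auto simp: w_def b_def)
      qed
    qed
    then obtain i where i: "i \<in> A" "i \<noteq> a" "w a (f i) + w i b < w a b + w i (f i)" by blast
    define g where "g = f \<circ> transpose a i"
    have g: "bij_betw g A B"
      unfolding g_def using f a i(1) by (intro bij_betw_trans[of _ A A]) auto
    have split: "(\<Sum>x \<in> A. h x) = h a + h i + (\<Sum>x \<in> A - {a, i}. h x)" for h :: "'a \<Rightarrow> nat"
    proof -
      have "(\<Sum>x \<in> A. h x) = (\<Sum>x \<in> A - {a, i}. h x) + (\<Sum>x \<in> {a, i}. h x)"
        using a i fin by (intro sum.subset_diff) auto
      then show ?thesis using i by simp
    qed
    have "(\<Sum>x \<in> A - {a, i}. w x (g x)) = (\<Sum>x \<in> A - {a, i}. w x (f x))"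
      by (intro sum.cong) (auto simp: g_def transpose_def)
    then have "cost g < cost f"
      unfolding cost_def split[of "\<lambda>x. w x (g x)"] split[of "\<lambda>x. w x (f x)"]
      using i by (simp add: g_def b_def)
    then show False using min[OF g] by simp
  qed
  then show ?thesis using f by blast
qed

section \<open>Reversing segments of a path\<close>

fun path_cost :: "('a \<Rightarrow> 'a \<Rightarrow> nat) \<Rightarrow> 'a list \<Rightarrow> nat" where
  "path_cost w (x # y # xs) = w x y + path_cost w (y # xs)"
| "path_cost w xs = 0"

lemma path_cost_append:
  "xs \<noteq> [] \<Longrightarrow> ys \<noteq> [] \<Longrightarrow>
    path_cost w (xs @ ys) = path_cost w xs + w (last xs) (hd ys) + path_cost w ys"
  by (induction w xs rule: path_cost.induct) (auto simp: neq_Nil_conv)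

lemma path_cost_rev:
  assumes "\<And>x y. w x y = w y x"
  shows "path_cost w (rev xs) = path_cost w xs"
proof (induction xs rule: induct_list012)
  case (3 x y xs)
  then show ?case using path_cost_append[of "rev xs @ [y]" "[x]" w] assms[of x y] by simp
qed auto

text \<open>The 2-opt move known from the travelling salesman problem: reversing the segment between
  two links replaces just these links. The costs are added on both sides because natural subtraction
  truncates.\<close>

lemma two_opt:
  assumes sym: "\<And>x y. w x y = w y x" and ij: "i < j" "Suc j < length xs"
  shows "\<exists>ys. mset ys = mset xs \<and> hd ys = hd xs \<and> last ys = last xs \<and>
    path_cost w ys + w (xs ! i) (xs ! Suc i) + w (xs ! j) (xs ! Suc j) =
    path_cost w xs + w (xs ! i) (xs ! j) + w (xs ! Suc i) (xs ! Suc j)"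
proof -
  define P where "P = take (Suc i) xs"
  define M where "M = take (j - i) (drop (Suc i) xs)"
  define Q where "Q = drop (Suc j) xs"
  have "drop (Suc i) xs = M @ Q"
    using ij append_take_drop_id[of "j - i" "drop (Suc i) xs"] by (simp add: M_def Q_def)
  then have xs: "xs = P @ M @ Q" by (metis P_def append_take_drop_id)
  have ne: "P \<noteq> []" "M \<noteq> []" "Q \<noteq> []" using ij by (auto simp: P_def M_def Q_def)
  have ends: "last P = xs ! i" "hd M = xs ! Suc i" "last M = xs ! j" "hd Q = xs ! Suc j"
    using ij ne by (auto simp: P_def M_def Q_def last_conv_nth hd_conv_nth min_def)
  have "path_cost w (P @ rev M @ Q) + w (xs ! i) (xs ! Suc i) + w (xs ! j) (xs ! Suc j) =
    path_cost w xs + w (xs ! i) (xs ! j) + w (xs ! Suc i) (xs ! Suc j)"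
    using ne arg_cong[OF xs, of "path_cost w"]
    by (simp add: path_cost_append path_cost_rev[OF sym] hd_rev last_rev flip: ends)
  moreover have "hd (P @ rev M @ Q) = hd xs" "last (P @ rev M @ Q) = last xs"
    "mset (P @ rev M @ Q) = mset xs"
    using ne by (auto simp: xs)
  ultimately show ?thesis by blast
qed

lemma path_cost_0_iff: "path_cost w xs = 0 \<longleftrightarrow> successively (\<lambda>x y. w x y = 0) xs"
  by (induction w xs rule: path_cost.induct) auto

text \<open>The exchange argument of the matching with a reversal in place of a swap. The end
  vertices never lie in the reversed segment, so \<open>s\<close> and \<open>t\<close> can be
  prescribed. The slack 2 in \<open>deg\<close> pays for the end vertex that starts (or ends) no
  link and for the defective link itself, which must not be chosen.\<close>

lemma hamilton_path_by_reversals: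
  fixes R :: "'a \<Rightarrow> 'a \<Rightarrow> bool"
  assumes fin: "finite X" "finite E" and sym: "\<And>x y. R x y \<Longrightarrow> R y x"
    and good: "\<And>x. x \<in> X \<Longrightarrow> x \<notin> E \<Longrightarrow> card {y \<in> X. \<not> R x y} \<le> k"
    and deg: "\<And>x. x \<in> X \<Longrightarrow> k + card E + 2 < card {y \<in> X. R x y}"
    and st: "s \<in> X" "t \<in> X" "s \<noteq> t"
  shows "\<exists>xs. distinct xs \<and> set xs = X \<and> hd xs = s \<and> last xs = t \<and> successively R xs"
proof -
  define w :: "'a \<Rightarrow> 'a \<Rightarrow> nat" where
    "w x y = (if R x y then 0 else if x \<in> E \<and> y \<in> E then 2 else 1)" for x y
  have w_sym: "w x y = w y x" for x y using sym by (auto simp: w_def)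
  define ok where "ok xs \<longleftrightarrow> distinct xs \<and> set xs = X \<and> hd xs = s \<and> last xs = t" for xs
  obtain zs where "set zs = X - {s, t}" "distinct zs"
    using finite_distinct_list[of "X - {s, t}"] fin by auto
  then have "ok (s # zs @ [t])" using st by (auto simp: ok_def)
  then obtain xs where ok: "ok xs" and min: "\<And>ys. ok ys \<Longrightarrow> path_cost w xs \<le> path_cost w ys"
    using ex_has_least_nat[of ok _ "path_cost w"] by blast
  have xs: "distinct xs" "set xs = X" using ok by (auto simp: ok_def)
  have "path_cost w xs = 0"
  proof (rule ccontr)
    assume "path_cost w xs \<noteq> 0"
    then obtain j where j: "Suc j < length xs" "\<not> R (xs ! j) (xs ! Suc j)"
      unfolding path_cost_0_iff successively_conv_nth by (auto simp: w_def split: if_splits)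
    define a b where "a = xs ! j" and "b = xs ! Suc j"
    have ab: "a \<in> X" "b \<in> X" "\<not> R a b" using j xs by (auto simp: a_def b_def)
    define I where "I = {i. Suc i < length xs}"
    have finI: "finite {i \<in> I. Q i}" for Q
      by (rule finite_subset[of _ "{..<length xs}"]) (auto simp: I_def)
    have count: "card {i. i < length xs \<and> Q (xs ! i)} = card {x \<in> X. Q x}" for Q
      using xs by (intro bij_betw_same_card[of "(!) xs"])
        (auto simp: bij_betw_def inj_on_def nth_eq_iff_index_eq in_set_conv_nth)
    have le0: "card {i \<in> I. Q (xs ! i)} \<le> card {x \<in> X. Q x}" for Q
      unfolding count[symmetric] by (intro card_mono) (auto simp: I_def)
    have le1: "card {i \<in> I. Q (xs ! Suc i)} \<le> card {x \<in> X. Q x}" for Q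
      unfolding count[symmetric] by (intro card_inj_on_le[of Suc]) (auto simp: I_def)
    have ge0: "card {x \<in> X. Q x} \<le> card {i \<in> I. Q (xs ! i)} + 1" for Q
    proof -
      have "card {i. i < length xs \<and> Q (xs ! i)} \<le> card (insert (length xs - 1) {i \<in> I. Q (xs ! i)})"
        by (intro card_mono) (auto simp: finI, auto simp: I_def)
      also have "\<dots> \<le> card {i \<in> I. Q (xs ! i)} + 1" using finI by (simp add: card_insert_if)
      finally show ?thesis by (simp add: count)
    qed
    have ge1: "card {x \<in> X. Q x} \<le> card {i \<in> I. Q (xs ! Suc i)} + 1" for Q
    proof -
      have "card {i. i < length xs \<and> Q (xs ! i)} \<le> card (insert 0 (Suc ` {i \<in> I. Q (xs ! Suc i)}))"
      proof (intro card_mono subsetI)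
        fix i assume "i \<in> {i. i < length xs \<and> Q (xs ! i)}"
        then show "i \<in> insert 0 (Suc ` {i \<in> I. Q (xs ! Suc i)})" by (cases i) (auto simp: I_def)
      qed (simp add: finI)
      also have "\<dots> \<le> card {i \<in> I. Q (xs ! Suc i)} + 1"
        using finI by (simp add: card_insert_if card_image)
      finally show ?thesis by (simp add: count)
    qed
    have pick: "\<exists>i \<in> I. i \<noteq> j \<and> U i \<and> \<not> V i"
      if "card {i \<in> I. V i} + 1 < card {i \<in> I. U i}" for U V
    proof (rule ccontr)
      assume "\<not> ?thesis"
      then have "{i \<in> I. U i} \<subseteq> insert j {i \<in> I. V i}" by auto
      then have "card {i \<in> I. U i} \<le> card (insert j {i \<in> I. V i})"
        by (intro card_mono) (auto simp: finI)
      also have "\<dots> \<le> card {i \<in> I. V i} + 1" using finI by (simp add: card_insert_if)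
      finally show False using that by simp
    qed
    have "\<exists>i \<in> I. i \<noteq> j \<and> w a (xs ! i) + w b (xs ! Suc i) < w a b + w (xs ! i) (xs ! Suc i)"
    proof -
      consider "a \<notin> E" | "b \<notin> E" | "a \<in> E" "b \<in> E" by blast
      then show ?thesis
      proof cases
        case 1
        have "\<exists>i \<in> I. i \<noteq> j \<and> R b (xs ! Suc i) \<and> \<not> \<not> R a (xs ! i)"
          using good[OF ab(1) 1] deg[OF ab(2)] le0[of "\<lambda>y. \<not> R a y"] ge1[of "R b"]
          by (intro pick) linarith
        then show ?thesis using ab by (auto simp: w_def)
      next
        case 2
        have "\<exists>i \<in> I. i \<noteq> j \<and> R a (xs ! i) \<and> \<not> \<not> R b (xs ! Suc i)"
          using good[OF ab(2) 2] deg[OF ab(1)] le1[of "\<lambda>y. \<not> R b y"] ge0[of "R a"]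
          by (intro pick) linarith
        then show ?thesis using ab by (auto simp: w_def)
      next
        case 3
        have "card {x \<in> X. x \<in> E} \<le> card E" using fin by (intro card_mono) auto
        then have "\<exists>i \<in> I. i \<noteq> j \<and> R a (xs ! i) \<and> \<not> xs ! Suc i \<in> E"
          using deg[OF ab(1)] le1[of "\<lambda>y. y \<in> E"] ge0[of "R a"]
          by (intro pick) linarith
        then show ?thesis using ab 3 by (auto simp: w_def)
      qed
    qed
    then obtain i where i: "Suc i < length xs" "i \<noteq> j"
      "w a (xs ! i) + w b (xs ! Suc i) < w a b + w (xs ! i) (xs ! Suc i)" by (auto simp: I_def)
    \<comment> \<open>The move wants the earlier link first; either order produces the same new
      links.\<close>
    have "\<exists>ys. mset ys = mset xs \<and> hd ys = hd xs \<and> last ys = last xs \<and>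
      path_cost w ys + w (xs ! i) (xs ! Suc i) + w a b =
      path_cost w xs + w a (xs ! i) + w b (xs ! Suc i)"
    proof (cases "i < j")
      case True
      from two_opt[OF w_sym this j(1)] show ?thesis
        unfolding a_def b_def w_sym[of "xs ! j" "xs ! i"] w_sym[of "xs ! Suc j" "xs ! Suc i"] .
    next
      case False
      then have "j < i" using i by simp
      from two_opt[OF w_sym this i(1)] show ?thesis
        unfolding a_def b_def by (simp add: add.commute add.left_commute)
    qed
    then obtain ys where ys: "mset ys = mset xs" "hd ys = hd xs" "last ys = last xs"
      "path_cost w ys + w (xs ! i) (xs ! Suc i) + w a b =
        path_cost w xs + w a (xs ! i) + w b (xs ! Suc i)" by blast
    have "ok ys" using ok ys mset_eq_imp_distinct_iff[OF ys(1)] mset_eq_setD[OF ys(1)]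
      by (simp add: ok_def)
    then show False using min[of ys] ys(4) i(3) by linarith
  qed
  then have "successively R xs"
    unfolding path_cost_0_iff by (rule successively_mono) (auto simp: w_def split: if_splits)
  then show ?thesis using ok by (auto simp: ok_def)
qed

section \<open>Halin graphs from ordered trees\<close>

text \<open>Ordering the children fixes the plane embedding. The cyclic order of the leaves thus
  becomes a recursively defined list, and the face walk is accessible to structural
  induction.\<close>

datatype 'a rtree = Node (root: 'a) (children: "'a rtree list")

fun labels :: "'a rtree \<Rightarrow> 'a list" where
  "labels (Node x ts) = x # concat (map labels ts)"

fun leaf_list :: "'a rtree \<Rightarrow> 'a list" where
  "leaf_list (Node x ts) = (if ts = [] then [x] else concat (map leaf_list ts))"

fun links :: "'a rtree \<Rightarrow> ('a \<times> 'a) set" where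
  "links (Node x ts) = (\<Union>t \<in> set ts. insert (x, root t) (links t))"

text \<open>Below the root of the whole tree the degree is one more than the number of children, so
  a single child is the forbidden case. The root of the whole tree is treated separately.\<close>

fun branching :: "'a rtree \<Rightarrow> bool" where
  "branching (Node x ts) \<longleftrightarrow> length ts \<noteq> 1 \<and> (\<forall>t \<in> set ts. branching t)"

text \<open>\<open>ps\<close> carries the parent: empty at the root of the whole tree, a singleton
  below it. Each vertex is paired with its neighbours in cyclic order, the parent first.\<close>

fun rotations :: "'a list \<Rightarrow> 'a rtree \<Rightarrow> ('a \<times> 'a list) list" where
  "rotations ps (Node x ts) = (x, ps @ map root ts) # concat (map (rotations [x]) ts)"

lemma root_in_labels [simp]: "root t \<in> set (labels t)"
  by (cases t) auto

lemma links_subset: "links t \<subseteq> set (labels t) \<times> set (labels t)"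
proof (induction t)
  case (Node x ts)
  then show ?case by fastforce
qed

lemma map_fst_rotations: "map fst (rotations ps t) = labels t"
  by (induction ps t rule: rotations.induct) (simp add: map_concat comp_def cong: map_cong)

lemma distinct_concat_same:
  "distinct (concat (map f ts)) \<Longrightarrow> t \<in> set ts \<Longrightarrow> t' \<in> set ts \<Longrightarrow> v \<in> set (f t) \<Longrightarrow> v \<in> set (f t')
    \<Longrightarrow> t = t'"
  by (induction ts) auto

lemma distinct_concat_child:
  "distinct (concat (map f ts)) \<Longrightarrow> t \<in> set ts \<Longrightarrow> distinct (f t)"
  by (induction ts) auto

lemma distinct_map_root: "distinct (concat (map labels ts)) \<Longrightarrow> distinct (map root ts)"
proof (induction ts)
  case (Cons t ts)
  have "root t \<noteq> root s" if "s \<in> set ts" for s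
  proof
    assume "root t = root s"
    then have "root s \<in> set (labels t)" using root_in_labels[of t] by simp
    moreover have "root s \<in> set (concat (map labels ts))" 
      unfolding set_concat set_map using that root_in_labels[of s] by blast
    ultimately show False using Cons.prems by fastforce
  qed
  then have "root t \<notin> root ` set ts" by blast
  then show ?case using Cons by simp
qed simp

lemma link_to_root: "distinct (labels t) \<Longrightarrow> (x, root t) \<notin> links t"
proof (cases t)
  case (Node r ts)
  assume d: "distinct (labels t)"
  show ?thesis
  proof
    assume "(x, root t) \<in> links t"
    then obtain s where "s \<in> set ts" "r \<in> set (labels s)"
      using links_subset Node by fastforce
    then show False using d Node by auto
  qed
qed

lemma unique_parent:
  "distinct (labels t) \<Longrightarrow> (x, y) \<in> links t \<Longrightarrow> (x', y) \<in> links t \<Longrightarrow> x = x'"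
proof (induction t)
  case (Node r ts)
  have d: "distinct (concat (map labels ts))" using Node.prems by simp
  obtain s where s: "s \<in> set ts" "(x, y) = (r, root s) \<or> (x, y) \<in> links s"
    using Node.prems(2) by auto
  obtain s' where s': "s' \<in> set ts" "(x', y) = (r, root s') \<or> (x', y) \<in> links s'"
    using Node.prems(3) by auto
  have "y \<in> set (labels s)" using s(2) links_subset[of s] by auto
  moreover have "y \<in> set (labels s')" using s'(2) links_subset[of s'] by auto
  ultimately have "s = s'" using distinct_concat_same[OF d s(1) s'(1)] by blast
  moreover have "distinct (labels s)" using distinct_concat_child[OF d s(1)] .
  ultimately show ?case using s s' link_to_root[of s] Node.IH[OF s(1), of] by auto
qed

text \<open>Stands in for the depth: a quantity that grows along every link rules out loops and,
  through its maximum, cycles.\<close>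

lemma link_rank:
  "distinct (labels t) \<Longrightarrow> \<exists>r :: 'a \<Rightarrow> nat. \<forall>(x, y) \<in> links t. r x < r y"
proof (induction t)
  case (Node x ts)
  have d: "distinct (concat (map labels ts))" using Node.prems by simp
  have "\<forall>t \<in> set ts. \<exists>r :: 'a \<Rightarrow> nat. \<forall>(x, y) \<in> links t. r x < r y"
    using Node.IH distinct_concat_child[OF d] by blast
  then obtain f :: "'a rtree \<Rightarrow> 'a \<Rightarrow> nat" where
    f: "\<And>t y z. t \<in> set ts \<Longrightarrow> (y, z) \<in> links t \<Longrightarrow> f t y < f t z"
    unfolding bchoice_iff by fast
  define sub where "sub v = (SOME t. t \<in> set ts \<and> v \<in> set (labels t))" for v
  have sub: "sub v = t" if "t \<in> set ts" "v \<in> set (labels t)" for t v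
    unfolding sub_def using that distinct_concat_same[OF d]
    by (intro some_equality) blast+
  define r where "r v = (if v = x then 0 else Suc (f (sub v) v))" for v
  have "r y < r z" if yz: "(y, z) \<in> links (Node x ts)" for y z
  proof -
    obtain t where t: "t \<in> set ts" "(y, z) = (x, root t) \<or> (y, z) \<in> links t"
      using yz by auto
    have z: "z \<in> set (labels t)" using t links_subset by fastforce
    then have "z \<noteq> x" using Node.prems t(1) by auto
    moreover have "y \<in> set (labels t) \<and> y \<noteq> x" if "(y, z) \<in> links t"
      using that links_subset Node.prems t(1) by fastforce
    ultimately show ?thesis using t z sub f by (auto simp: r_def)
  qed
  then show ?case by blast
qed

lemma rotations_neighbours:
  "(x, l) \<in> set (rotations ps t) \<Longrightarrow> distinct (ps @ labels t) \<Longrightarrow>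
    distinct l \<and> set l = {y. (x, y) \<in> links t \<or> (y, x) \<in> links t} \<union> (if x = root t then set ps else {})"
proof (induction t arbitrary: ps)
  case (Node r ts)
  have d: "distinct (concat (map labels ts))" "r \<notin> set (concat (map labels ts))"
    using Node.prems by auto
  show ?case
  proof (cases "x = r")
    case True
    have "x \<notin> fst ` set (rotations [r] t)" if "t \<in> set ts" for t
    proof -
      have "fst ` set (rotations [r] t) = set (labels t)"
        by (simp flip: map_fst_rotations[of "[r]"])
      then show ?thesis using d that True by auto
    qed
    then have "l = ps @ map root ts" using Node.prems(1) True by force
    moreover have "distinct (ps @ map root ts)"
      using Node.prems(2) distinct_map_root[OF d(1)] by fastforce
    moreover have "(y, x) \<notin> links (Node r ts)" for y
      using link_to_root[of "Node r ts" y] Node.prems(2) True by auto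
    moreover have "{y. (x, y) \<in> links (Node r ts)} = root ` set ts"
      using links_subset d True by fastforce
    ultimately show ?thesis using True by auto
  next
    case False
    then obtain t where t: "t \<in> set ts" "(x, l) \<in> set (rotations [r] t)"
      using Node.prems(1) by auto
    have x: "x \<in> set (labels t)" using t(2) by (force simp flip: map_fst_rotations[of "[r]"])
    have "distinct ([r] @ labels t)" using d t(1) distinct_concat_child[OF d(1)] by auto
    note IH = Node.IH[OF t this]
    have other: "t' = t" if "t' \<in> set ts" "x \<in> set (labels t')" for t'
      using distinct_concat_same[OF d(1) that(1) t(1)] that(2) x by blast
    have "(x, y) \<in> links (Node r ts) \<longleftrightarrow> (x, y) \<in> links t" for y
      using other links_subset t(1) False by fastforce
    moreover have "(y, x) \<in> links (Node r ts) \<longleftrightarrow> (y, x) \<in> links t \<or> y = r \<and> x = root t" for y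
    proof
      assume "(y, x) \<in> links (Node r ts)"
      then obtain t' where t': "t' \<in> set ts" "(y, x) = (r, root t') \<or> (y, x) \<in> links t'" by auto
      then have "x \<in> set (labels t')" using links_subset by fastforce
      then have "t' = t" using other t' by blast
      then show "(y, x) \<in> links t \<or> y = r \<and> x = root t" using t' by auto
    qed (use t in auto)
    ultimately show ?thesis using IH False by auto
  qed
qed

lemma set_leaf_list_subset: "set (leaf_list t) \<subseteq> set (labels t)"
  by (induction t) auto

lemma leaf_list_nonempty: "leaf_list t \<noteq> []"
proof (induction t)
  case (Node x ts)
  then show ?case by (cases ts) auto
qed

lemma leaf_list_of_child:
  assumes d: "distinct (concat (map labels ts))" and t: "t \<in> set ts" and x: "x \<in> set (labels t)"
  shows "x \<in> set (leaf_list (Node r ts)) \<longleftrightarrow> x \<in> set (leaf_list t)"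
proof
  assume "x \<in> set (leaf_list (Node r ts))"
  then obtain t' where t': "t' \<in> set ts" "x \<in> set (leaf_list t')" using t by (auto split: if_splits)
  then have "t' = t" 
    using distinct_concat_same[OF d t'(1) t _ x] set_leaf_list_subset[of t'] by auto
  then show "x \<in> set (leaf_list t)" using t' by simp
qed (use t in auto)

lemma rotations_leaf:
  "(x, l) \<in> set (rotations [p] t) \<Longrightarrow> distinct (labels t) \<Longrightarrow> branching t \<Longrightarrow>
    length l \<noteq> 2 \<and> (length l = 1 \<longleftrightarrow> x \<in> set (leaf_list t))"
proof (induction t arbitrary: p)
  case (Node r ts)
  have d: "distinct (concat (map labels ts))" "r \<notin> set (concat (map labels ts))"
    using Node.prems by auto
  show ?case
  proof (cases "(x, l) = (r, p # map root ts)")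
    case True
    have "r \<notin> set (concat (map leaf_list ts))" using d set_leaf_list_subset by fastforce
    then show ?thesis using True Node.prems(3) by auto
  next
    case False
    then obtain t where t: "t \<in> set ts" "(x, l) \<in> set (rotations [r] t)"
      using Node.prems(1) by auto
    have x: "x \<in> set (labels t)" using t(2) by (force simp flip: map_fst_rotations[of "[r]"])
    have "x \<in> set (leaf_list (Node r ts)) \<longleftrightarrow> x \<in> set (leaf_list t)"
      using leaf_list_of_child[OF d(1) t(1) x] .
    then show ?thesis
      using Node.IH[OF t] distinct_concat_child[OF d(1) t(1)] Node.prems(3) t(1) by auto
  qed
qed

lemma root_reaches: "x \<in> set (labels t) \<Longrightarrow> (root t, x) \<in> (links t)\<^sup>*"
proof (induction t)
  case (Node r ts)
  show ?case
  proof (cases "x = r")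
    case False
    then obtain t where t: "t \<in> set ts" "x \<in> set (labels t)" using Node.prems by auto
    have "(root t, x) \<in> (links (Node r ts))\<^sup>*"
      using Node.IH[OF t] rtrancl_mono[of "links t" "links (Node r ts)"] t(1) by auto
    moreover have "(r, root t) \<in> links (Node r ts)" using t by auto
    ultimately show ?thesis by (simp add: converse_rtrancl_into_rtrancl)
  qed simp
qed

section \<open>Cyclic successors in a list\<close>

definition cyc_next :: "'a list \<Rightarrow> 'a \<Rightarrow> 'a" where
  "cyc_next l u = (case dropWhile (\<lambda>v. v \<noteq> u) l of _ # v # _ \<Rightarrow> v | _ \<Rightarrow> hd l)"

lemma cyc_next_append:
  "u \<notin> set ps \<Longrightarrow> cyc_next (ps @ u # qs) u = (case qs of v # _ \<Rightarrow> v | [] \<Rightarrow> hd (ps @ [u]))"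
  by (cases qs) (auto simp: cyc_next_def dropWhile_append)

lemma cyc_next_nth:
  assumes "distinct l" "i < length l"
  shows "cyc_next l (l ! i) = (if Suc i < length l then l ! Suc i else hd l)"
proof -
  have l: "l = take i l @ l ! i # drop (Suc i) l" using assms by (simp add: id_take_nth_drop)
  have "l ! i \<notin> set (take i l)"
    using assms by (auto simp: in_set_conv_nth nth_eq_iff_index_eq)
  then have "cyc_next l (l ! i) = (case drop (Suc i) l of v # _ \<Rightarrow> v | [] \<Rightarrow> hd (take i l @ [l ! i]))"
    using cyc_next_append[of "l ! i" "take i l" "drop (Suc i) l"] l by simp
  moreover have "hd (take i l @ [l ! i]) = hd l" using l by (cases "take i l") (metis append_Nil list.sel(1), metis append_Cons list.sel(1))
  ultimately show ?thesis
    using assms by (cases "Suc i < length l") (auto simp: Cons_nth_drop_Suc[symmetric])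
qed

lemma cyclic_on_cyc_next:
  assumes "distinct l" "l \<noteq> []"
  shows "cyclic_on (cyc_next l) (set l)"
proof -
  let ?f = "cyc_next l"
  have pos: "l ! i \<in> orbit ?f (hd l)" if "0 < i" "i < length l" for i
    using that
  proof (induction i)
    case (Suc i)
    show ?case
    proof (cases i)
      case 0
      then show ?thesis using cyc_next_nth[OF assms(1), of 0] Suc.prems assms(2)
        by (metis hd_conv_nth orbit.base One_nat_def Suc_lessD)
    next
      case (Suc j)
      then have "l ! i \<in> orbit ?f (hd l)" using Suc.IH \<open>Suc i < length l\<close> by simp
      then show ?thesis using cyc_next_nth[OF assms(1), of i] \<open>Suc i < length l\<close>
        by (metis Suc_lessD orbit.step)
    qed
  qed simp
  have "hd l \<in> orbit ?f (hd l)"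
  proof (cases "length l = 1")
    case True
    then show ?thesis using cyc_next_nth[OF assms(1), of 0] assms(2)
      by (metis One_nat_def hd_conv_nth less_irrefl orbit.base zero_less_one)
  next
    case False
    then have "l ! (length l - 1) \<in> orbit ?f (hd l)" using assms(2)
      by (intro pos) (auto simp: Suc_lessI neq_Nil_conv)
    moreover have "?f (l ! (length l - 1)) = hd l"
      using cyc_next_nth[OF assms(1), of "length l - 1"] assms(2) by simp
    ultimately show ?thesis by (metis orbit.step)
  qed
  then have sub: "set l \<subseteq> orbit ?f (hd l)"
    using pos assms(2) by (metis in_set_conv_nth hd_conv_nth subsetI gr0I)
  have closed: "?f v \<in> set l" if "v \<in> set l" for v
    using that assms cyc_next_nth[OF assms(1)] by (metis hd_in_set in_set_conv_nth nth_mem)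
  have "v \<in> set l" if "v \<in> orbit ?f (hd l)" for v
    using that by induction (use closed assms in auto)
  then show ?thesis unfolding cyclic_on_def using sub assms(2) by (metis hd_in_set subsetI subset_antisym)
qed

lemma successively_cyc_next:
  assumes "distinct l"
  shows "successively (\<lambda>u v. cyc_next l u = v) l"
  unfolding successively_conv_nth using cyc_next_nth[OF assms] by auto

section \<open>The boundary walk of a plane tree\<close>

text \<open>The list records the states that are left, \<open>a\<close> included and
  \<open>b\<close> excluded, so that walks can be concatenated without counting the junction
  twice.\<close>

fun walk :: "('b \<Rightarrow> 'b) \<Rightarrow> 'b \<Rightarrow> 'b list \<Rightarrow> 'b \<Rightarrow> bool" where
  "walk f a [] b \<longleftrightarrow> a = b"
| "walk f a (c # L) b \<longleftrightarrow> c = a \<and> walk f (f a) L b"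

lemma walk_append: "walk f a (L @ M) b \<longleftrightarrow> (\<exists>c. walk f a L c \<and> walk f c M b)"
  by (induction L arbitrary: a) auto

lemma walk_first_hit:
  "walk f a L b \<Longrightarrow> P ((f ^^ k) a) \<Longrightarrow> \<forall>j<k. \<not> P ((f ^^ j) a) \<Longrightarrow> filter P L \<noteq> [] \<Longrightarrow>
    (f ^^ k) a = hd (filter P L)"
proof (induction L arbitrary: a k)
  case (Cons c L)
  show ?case
  proof (cases "P a")
    case True
    then have "k = 0" using Cons.prems(3) by (metis funpow_0 gr0I)
    then show ?thesis using Cons.prems True by auto
  next
    case False
    then obtain k' where k: "k = Suc k'" using Cons.prems(2) by (cases k) auto
    have "(f ^^ k') (f a) = hd (filter P L)"
    proof (rule Cons.IH)
      show "\<forall>j<k'. \<not> P ((f ^^ j) (f a))"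
        using Cons.prems(3) k by (metis Suc_less_eq comp_apply funpow_Suc_right)
    qed (use Cons.prems False k in \<open>auto simp: funpow_swap1\<close>)
    then show ?thesis using Cons.prems False k by (auto simp: funpow_swap1)
  qed
qed simp

text \<open>Shared by both kinds of inner vertices: after the last child the rotation at
  \<open>x\<close> leads to \<open>q\<close>, which is the parent of \<open>x\<close> or, at the
  root of the whole tree, its first child again. The returns to \<open>x\<close> leave no trace in
  the filtered list because \<open>P x\<close> fails.\<close>

lemma children_walk:
  assumes "\<And>t. t \<in> set ts \<Longrightarrow>
      \<exists>L. walk (face_step \<rho>) (x, root t) L (root t, x) \<and> filter P (map snd L) = leaf_list t"
    and "\<not> P x" and "successively (\<lambda>u v. \<rho> x u = v) (map root ts)"
    and "\<rho> x (root (last ts)) = q" and "ts \<noteq> []"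
  shows "\<exists>L. walk (face_step \<rho>) (x, root (hd ts)) L (x, q) \<and>
    filter P (map snd L) = concat (map leaf_list ts)"
  using assms
proof (induction ts)
  case (Cons t ts)
  obtain L where L: "walk (face_step \<rho>) (x, root t) L (root t, x)" "filter P (map snd L) = leaf_list t"
    using Cons.prems(1) by auto
  define q' where "q' = (if ts = [] then q else root (hd ts))"
  have "walk (face_step \<rho>) (x, root t) (L @ [(root t, x)]) (x, q')"
    using L(1) Cons.prems(3,4)
    by (auto simp: walk_append face_step_def q'_def successively_Cons hd_map split: if_splits)
  moreover have "\<exists>M. walk (face_step \<rho>) (x, q') M (x, q) \<and>
    filter P (map snd M) = concat (map leaf_list ts)"
  proof (cases "ts = []")
    case True
    then show ?thesis by (intro exI[of _ "[]"]) (simp add: q'_def)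
  next
    case False
    then show ?thesis using Cons by (auto simp: q'_def successively_Cons)
  qed
  ultimately obtain M where "walk (face_step \<rho>) (x, root t) ((L @ [(root t, x)]) @ M) (x, q)"
    "filter P (map snd M) = concat (map leaf_list ts)"
    unfolding walk_append[of _ _ "L @ [(root t, x)]"] by blast
  then show ?case using L(2) Cons.prems(2) by (intro exI[of _ "(L @ [(root t, x)]) @ M"]) auto
qed simp

text \<open>The boundary walk traverses the subtree depth first: it enters along
  \<open>(p, root t)\<close> and comes back to the reverse arc, which \<open>L\<close> does not
  contain. Only heads of arcs are recorded, so a leaf appears once, on the arc that enters
  it.\<close>

lemma face_walk:
  "distinct (p # labels t) \<Longrightarrow> (\<And>x l. (x, l) \<in> set (rotations [p] t) \<Longrightarrow> \<rho> x = cyc_next l) \<Longrightarrow>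
    (\<And>x. x \<in> set (labels t) \<Longrightarrow> P x \<longleftrightarrow> x \<in> set (leaf_list t)) \<Longrightarrow>
    \<exists>L. walk (face_step \<rho>) (p, root t) L (root t, p) \<and> filter P (map snd L) = leaf_list t"
proof (induction t arbitrary: p)
  case (Node x ts)
  have d: "distinct (concat (map labels ts))" "x \<notin> set (concat (map labels ts))" "p \<noteq> x"
    "p \<notin> set (concat (map labels ts))"
    using Node.prems(1) by auto
  have \<rho>x: "\<rho> x = cyc_next (p # map root ts)" using Node.prems(2) by simp
  show ?case
  proof (cases "ts = []")
    case True
    then show ?thesis using Node.prems(3)[of x] \<rho>x
      by (intro exI[of _ "[(p, x)]"]) (simp add: face_step_def cyc_next_def)
  next
    case False
    have nP: "\<not> P x" using Node.prems(3)[of x] False d(2) set_leaf_list_subset by fastforce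
    have dl: "distinct (p # map root ts)" using distinct_map_root[OF d(1)] d(4) by auto
    have succ: "successively (\<lambda>u v. \<rho> x u = v) (p # map root ts)"
      unfolding \<rho>x by (rule successively_cyc_next[OF dl])
    have last: "\<rho> x (root (last ts)) = p"
      using cyc_next_nth[OF dl, of "length ts"] False unfolding \<rho>x
      by (simp add: last_conv_nth nth_Cons')
    have "\<exists>L. walk (face_step \<rho>) (x, root (hd ts)) L (x, p) \<and>
      filter P (map snd L) = concat (map leaf_list ts)"
    proof (rule children_walk[where P = P])
      fix t assume t: "t \<in> set ts"
      show "\<exists>L. walk (face_step \<rho>) (x, root t) L (root t, x) \<and> filter P (map snd L) = leaf_list t"
      proof (rule Node.IH[OF t])
        show "distinct (x # labels t)" using d t distinct_concat_child[OF d(1)] by auto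
        show "\<rho> y = cyc_next l" if "(y, l) \<in> set (rotations [x] t)" for y l
          using Node.prems(2) that t by auto
        show "P y \<longleftrightarrow> y \<in> set (leaf_list t)" if y: "y \<in> set (labels t)" for y
        proof -
          have "y \<in> set (leaf_list (Node x ts)) \<longleftrightarrow> y \<in> set (leaf_list t)"
            using leaf_list_of_child[OF d(1) t y] .
          then show ?thesis using Node.prems(3)[of y] y t by auto
        qed
      qed
    qed (use nP succ last False in \<open>simp_all add: successively_Cons\<close>)
    then obtain L where L: "walk (face_step \<rho>) (x, root (hd ts)) L (x, p)"
      "filter P (map snd L) = concat (map leaf_list ts)" by blast
    have "\<rho> x p = root (hd ts)" using succ False by (simp add: successively_Cons hd_map)
    then show ?thesis using L nP False
      by (intro exI[of _ "(p, x) # L"]) (simp add: face_step_def)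
  qed
qed


section \<open>The plane tree of an ordered tree and its Halin graph\<close>

lemma pcas_nth: "pcas u p v \<Longrightarrow> Suc i < length p \<Longrightarrow> fst (p ! Suc i) = snd (p ! i)"
proof (induction p arbitrary: u i)
  case (Cons e p)
  then show ?case by (cases i; cases p) auto
qed simp

lemma pcas_ends: "pcas u p v \<Longrightarrow> p \<noteq> [] \<Longrightarrow> fst (p ! 0) = u \<and> snd (p ! (length p - 1)) = v"
proof (induction p arbitrary: u)
  case (Cons e p)
  then show ?case by (cases p) auto
qed simp

text \<open>The root has no parent, so three children take over the part of \<open>branching\<close>
  there and give it degree at least 3.\<close>

locale plane_rtree =
  fixes t :: "'a rtree"
  assumes distinct_labels: "distinct (labels t)"
    and branching_children: "\<forall>s \<in> set (children t). branching s"
    and three_children: "length (children t) \<ge> 3"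
begin

definition tree_graph :: "'a pair_pre_digraph" where
  "tree_graph = \<lparr>pverts = set (labels t), parcs = {(x, y). (x, y) \<in> links t \<or> (y, x) \<in> links t}\<rparr>"

definition rho :: "'a \<Rightarrow> 'a \<Rightarrow> 'a" where
  "rho x = cyc_next (the (map_of (rotations [] t) x))"

lemma rho_eq: "(x, l) \<in> set (rotations [] t) \<Longrightarrow> rho x = cyc_next l"
  using distinct_labels by (simp add: rho_def map_fst_rotations)

lemma rotation_exists: "x \<in> set (labels t) \<Longrightarrow> \<exists>l. (x, l) \<in> set (rotations [] t)"
  using map_fst_rotations[of "[]" t] by (metis (no_types, lifting) imageE list.set_map prod.collapse)

lemma neighbours_eq: "(x, l) \<in> set (rotations [] t) \<Longrightarrow> neighbours tree_graph x = set l \<and> distinct l"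
  using rotations_neighbours[of x l "[]" t] distinct_labels
  by (auto simp: neighbours_def tree_graph_def)

lemma links_no_loop: "(x, y) \<in> links t \<Longrightarrow> x \<noteq> y"
  using link_rank[OF distinct_labels] by fastforce

lemma pair_graph_tree_graph: "pair_graph tree_graph"
proof
  show "finite (parcs tree_graph)"
    by (rule finite_subset[of _ "set (labels t) \<times> set (labels t)"])
      (use links_subset in \<open>auto simp: tree_graph_def\<close>)
  show "symmetric (with_proj tree_graph)"
    by (auto simp: symmetric_def sym_def tree_graph_def)
qed (use links_subset links_no_loop in \<open>fastforce simp: tree_graph_def\<close>)+

lemma out_degree_eq:
  assumes "(x, l) \<in> set (rotations [] t)"
  shows "out_degree (with_proj tree_graph) x = length l"
proof -
  have "out_arcs (with_proj tree_graph) x = Pair x ` neighbours tree_graph x"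
    by (auto simp: out_arcs_def neighbours_def)
  then have "out_degree (with_proj tree_graph) x = card (neighbours tree_graph x)"
    unfolding out_degree_def by (simp add: card_image inj_on_def)
  then show ?thesis using neighbours_eq[OF assms] by (simp add: distinct_card)
qed

lemma rotation_leaf:
  assumes "(x, l) \<in> set (rotations [] t)"
  shows "length l \<noteq> 2 \<and> (length l = 1 \<longleftrightarrow> x \<in> set (leaf_list t))"
proof -
  obtain r ts where t: "t = Node r ts" by (cases t)
  have d: "distinct (concat (map labels ts))" "r \<notin> set (concat (map labels ts))"
    using distinct_labels t by auto
  have ts: "ts \<noteq> []" using three_children t by auto
  show ?thesis
  proof (cases "(x, l) = (r, map root ts)")
    case True
    have "r \<notin> set (leaf_list t)" using d set_leaf_list_subset ts t by fastforce
    then show ?thesis using True three_children t by auto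
  next
    case False
    then obtain s where s: "s \<in> set ts" "(x, l) \<in> set (rotations [r] s)"
      using assms t by auto
    have x: "x \<in> set (labels s)" using s(2) by (force simp flip: map_fst_rotations[of "[r]"])
    show ?thesis
      using rotations_leaf[OF s(2)] leaf_list_of_child[OF d(1) s(1) x, of r]
        distinct_concat_child[OF d(1) s(1)] branching_children s(1) t by auto
  qed
qed

lemma leaves_eq: "leaves tree_graph = set (leaf_list t)"
proof -
  have "x \<in> leaves tree_graph \<longleftrightarrow> x \<in> set (leaf_list t)" if "x \<in> set (labels t)" for x
    using rotation_exists[OF that] rotation_leaf out_degree_eq that
    by (auto simp: leaves_def tree_graph_def)
  then show ?thesis using set_leaf_list_subset[of t] by (auto simp: leaves_def tree_graph_def)
qed

lemma connected_tree_graph: "connected (with_proj tree_graph)"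
proof -
  interpret pair_graph tree_graph by (rule pair_graph_tree_graph)
  have sym: "symmetric (with_proj tree_graph)" using pair_sym_arcs by simp
  \<comment> \<open>Connectedness is defined through the symmetric closure, which adds no arc to a
    symmetric digraph.\<close>
  have arcs: "parcs (mk_symmetric (with_proj tree_graph)) = parcs tree_graph"
    using adj_mk_symmetric_eq[OF sym] by simp
  interpret M: pair_wf_digraph "mk_symmetric (with_proj tree_graph)"
    by (rule wellformed_mk_symmetric)
  have "links t \<subseteq> parcs tree_graph" by (auto simp: tree_graph_def)
  then have down: "(root t, x) \<in> (parcs tree_graph)\<^sup>*" if "x \<in> set (labels t)" for x
    using rtrancl_mono root_reaches[OF that] by blast
  moreover have "sym ((parcs tree_graph)\<^sup>*)"
    by (intro sym_rtrancl) (auto simp: sym_def tree_graph_def)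
  ultimately have "(x, root t) \<in> (parcs tree_graph)\<^sup>*" if "x \<in> set (labels t)" for x
    using that by (meson symD)
  then have "(x, y) \<in> (parcs tree_graph)\<^sup>*"
    if "x \<in> set (labels t)" "y \<in> set (labels t)" for x y
    using that down by (meson rtrancl_trans)
  then have "x \<rightarrow>\<^sup>*\<^bsub>with_proj (mk_symmetric (with_proj tree_graph))\<^esub> y"
    if "x \<in> set (labels t)" "y \<in> set (labels t)" for x y
    using that by (subst M.reachable_conv) (simp add: arcs, simp add: tree_graph_def)
  moreover have "set (labels t) \<noteq> {}" by (cases t) auto
  ultimately show ?thesis
    unfolding connected_def strongly_connected_def by (simp add: tree_graph_def)
qed

text \<open>At a vertex of maximal rank on a cycle both neighbours along the cycle must be its
  parent, hence equal; length at least 3 makes them distinct.\<close>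

lemma no_long_cycle:
  assumes "pre_digraph.cycle (with_proj tree_graph) p" "length p \<ge> 3"
  shows False
proof -
  interpret pair_graph tree_graph by (rule pair_graph_tree_graph)
  obtain u where u: "pcas u p u" "set p \<subseteq> parcs tree_graph" "distinct (tl (pawalk_verts u p))"
    using assms(1) unfolding cycle_def awalk_def by auto
  have "distinct (map snd p)"
    using awalk_verts_conv'[OF u(1)] u(3) assms(2) by (auto split: if_splits)
  then have inj: "i = j" if "i < length p" "j < length p" "snd (p ! i) = snd (p ! j)" for i j
    using that by (metis length_map nth_eq_iff_index_eq nth_map)
  obtain r :: "'a \<Rightarrow> nat" where r: "\<And>x y. (x, y) \<in> links t \<Longrightarrow> r x < r y"
    using link_rank[OF distinct_labels] by fast
  define h where "h i = r (snd (p ! i))" for i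
  have "Max (h ` {..<length p}) \<in> h ` {..<length p}" using assms(2) by (intro Max_in) (auto simp: lessThan_empty_iff)
  then obtain i where i: "i < length p" "h i = Max (h ` {..<length p})" by auto
  have max: "r (snd (p ! j)) \<le> r (snd (p ! i))" if "j < length p" for j
    using that i(2) by (simp flip: h_def)
  define v where "v = snd (p ! i)"
  define j where "j = (if i = 0 then length p - 1 else i - 1)"
  define k where "k = (if Suc i = length p then 0 else Suc i)"
  have jk: "j < length p" "k < length p" "j \<noteq> k" using i(1) assms(2) by (auto simp: j_def k_def)
  have ne: "p \<noteq> []" using assms(2) by auto
  have j: "fst (p ! i) = snd (p ! j)"
    using pcas_nth[OF u(1), of "i - 1"] pcas_ends[OF u(1) ne] i(1) by (auto simp: j_def)
  have k: "fst (p ! k) = v"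
  proof (cases "Suc i = length p")
    case True
    then have "length p - 1 = i" by simp
    then show ?thesis using pcas_ends[OF u(1) ne] True by (simp add: k_def v_def)
  next
    case False
    then have "Suc i < length p" using i(1) by simp
    then show ?thesis using pcas_nth[OF u(1)] False by (simp add: k_def v_def)
  qed
  have "p ! i \<in> parcs tree_graph" "p ! k \<in> parcs tree_graph" using u(2) i(1) jk by auto
  then have "(snd (p ! j), v) \<in> parcs tree_graph" "(v, snd (p ! k)) \<in> parcs tree_graph"
    using j k by (metis prod.collapse v_def)+
  then have "(snd (p ! j), v) \<in> links t" "(snd (p ! k), v) \<in> links t"
    using r max[OF jk(1)] max[OF jk(2)] unfolding v_def[symmetric]
    by (auto simp: tree_graph_def) (metis leD)+
  then have "snd (p ! j) = snd (p ! k)" using unique_parent[OF distinct_labels] by blast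
  then show False using inj jk by blast
qed

lemma hit_tree_graph: "homeomorphically_irreducible_tree tree_graph"
  unfolding homeomorphically_irreducible_tree_def undirected_tree_def
proof (intro conjI ballI pair_graph_tree_graph connected_tree_graph)
  fix v assume "v \<in> pverts tree_graph"
  then show "out_degree (with_proj tree_graph) v \<noteq> 2"
    using rotation_exists rotation_leaf out_degree_eq by (fastforce simp: tree_graph_def)
qed (use no_long_cycle in blast)

lemma card_tree_graph: "card (pverts tree_graph) \<ge> 4"
proof -
  obtain r ts where t: "t = Node r ts" by (cases t)
  have "length ts \<le> length (concat (map labels ts))" for ts :: "'a rtree list"
  proof (induction ts)
    case (Cons s ts)
    then show ?case by (cases s) auto
  qed simp
  from this[of ts] show ?thesis
    using distinct_card[OF distinct_labels] three_children
    by (simp add: tree_graph_def) (simp add: t)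
qed

lemma rotation_system_rho: "rotation_system tree_graph rho"
  unfolding rotation_system_def
proof (intro ballI impI)
  fix v assume v: "v \<in> pverts tree_graph" "neighbours tree_graph v \<noteq> {}"
  then obtain l where l: "(v, l) \<in> set (rotations [] t)"
    using rotation_exists by (auto simp: tree_graph_def)
  show "cyclic_on (rho v) (neighbours tree_graph v)"
    using neighbours_eq[OF l] v(2) rho_eq[OF l] cyclic_on_cyc_next[of l] by auto
qed

lemma boundary_walk:
  "\<exists>a L. walk (face_step rho) a L a \<and> filter (\<lambda>v. v \<in> leaves tree_graph) (map snd L) = leaf_list t"
proof -
  obtain r ts where t: "t = Node r ts" by (cases t)
  have d: "distinct (concat (map labels ts))" "r \<notin> set (concat (map labels ts))"
    using distinct_labels t by auto
  have ts: "ts \<noteq> []" using three_children t by auto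
  have leaf: "leaf_list t = concat (map leaf_list ts)" using t ts by simp
  have rot: "set (rotations [] t) = insert (r, map root ts) (\<Union>s \<in> set ts. set (rotations [r] s))"
    using t by simp
  have "r \<notin> set (concat (map leaf_list ts))" using d(2) set_leaf_list_subset by fastforce
  then have root: "r \<notin> leaves tree_graph" unfolding leaves_eq leaf .
  have rho: "rho r = cyc_next (map root ts)" by (rule rho_eq) (simp add: rot)
  have dl: "distinct (map root ts)" using distinct_map_root[OF d(1)] .
  have "\<exists>L. walk (face_step rho) (r, root (hd ts)) L (r, root (hd ts)) \<and>
    filter (\<lambda>v. v \<in> leaves tree_graph) (map snd L) = concat (map leaf_list ts)"
  proof (rule children_walk[where P = "\<lambda>v. v \<in> leaves tree_graph"])
    fix s assume s: "s \<in> set ts"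
    show "\<exists>L. walk (face_step rho) (r, root s) L (root s, r) \<and>
      filter (\<lambda>v. v \<in> leaves tree_graph) (map snd L) = leaf_list s"
    proof (rule face_walk)
      show "distinct (r # labels s)" using d s distinct_concat_child[OF d(1) s] by auto
      show "rho y = cyc_next l" if "(y, l) \<in> set (rotations [r] s)" for y l
        using that s by (intro rho_eq) (auto simp: rot)
      show "y \<in> leaves tree_graph \<longleftrightarrow> y \<in> set (leaf_list s)" if y: "y \<in> set (labels s)" for y
        using leaf_list_of_child[OF d(1) s y, of r] ts unfolding leaves_eq leaf by simp
    qed
  next
    show "successively (\<lambda>u v. rho r u = v) (map root ts)"
      unfolding rho by (rule successively_cyc_next[OF dl])
    show "rho r (root (last ts)) = root (hd ts)"
      using cyc_next_nth[OF dl, of "length ts - 1"] ts unfolding rho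
      by (simp add: last_conv_nth hd_map)
  qed (use root ts in auto)
  then show ?thesis unfolding leaf by blast
qed

text \<open>A leaf has only one neighbour, so after entering \<open>u\<close> the walk must continue
  along \<open>(u, v)\<close>. Restarting the closed walk at this arc turns the first leaf it meets
  into the head of the rotated leaf list; the final \<open>[u]\<close> covers a return to
  \<open>u\<close> itself.\<close>

lemma next_leaf_cyc:
  assumes "next_leaf tree_graph rho u w"
  shows "\<exists>X Y. leaf_list t = X @ u # Y \<and> w = hd (Y @ X @ [u])"
proof -
  let ?P = "\<lambda>e. snd e \<in> leaves tree_graph" and ?f = "face_step rho"
  obtain v k where u: "u \<in> leaves tree_graph" "w \<in> leaves tree_graph" "(u, v) \<in> parcs tree_graph"
    and k: "snd ((?f ^^ k) (u, v)) = w" "\<forall>j<k. snd ((?f ^^ j) (u, v)) \<notin> leaves tree_graph"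
    using assms unfolding next_leaf_def by blast
  obtain a L where L: "walk ?f a L a" "map snd (filter ?P L) = leaf_list t"
    using boundary_walk by (auto simp: filter_map comp_def)
  have "u \<in> set (map snd (filter ?P L))"
    unfolding L(2) using u(1) leaves_eq by blast
  then obtain p where "(p, u) \<in> set L" by auto
  then obtain L1 L2 where L12: "L = L1 @ (p, u) # L2" by (meson split_list)
  obtain l where l: "(u, l) \<in> set (rotations [] t)"
    using rotation_exists u(1) set_leaf_list_subset[of t] by (auto simp: leaves_eq)
  have "length l = 1" using rotation_leaf[OF l] u(1) by (simp add: leaves_eq)
  moreover have "v \<in> set l" using neighbours_eq[OF l] u(3) by (auto simp: neighbours_def)
  ultimately have "l = [v]" by (cases l) auto
  then have "?f (p, u) = (u, v)" using rho_eq[OF l] by (simp add: face_step_def cyc_next_def)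
  moreover have "walk ?f a L1 (p, u)" "walk ?f (?f (p, u)) L2 a"
    using L(1) unfolding L12 by (auto simp: walk_append)
  ultimately have "walk ?f (u, v) (L2 @ L1 @ [(p, u)]) (u, v)"
    unfolding walk_append by (intro exI[of _ a] exI[of _ "(p, u)"] conjI) simp_all
  then have "(?f ^^ k) (u, v) = hd (filter ?P (L2 @ L1 @ [(p, u)]))"
    using k u by (intro walk_first_hit) auto
  then have "w = snd (hd (filter ?P (L2 @ L1 @ [(p, u)])))" using k(1) by simp
  also have "\<dots> = hd (map snd (filter ?P (L2 @ L1 @ [(p, u)])))" using u(1) by (subst hd_map) auto
  finally have w: "w = hd (map snd (filter ?P L2) @ map snd (filter ?P L1) @ [u])" using u(1) by simp
  have "leaf_list t = map snd (filter ?P L1) @ u # map snd (filter ?P L2)"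
    using L(2) u(1) unfolding L12 by simp
  then show ?thesis using w by blast
qed

lemma spanning_halin:
  assumes G: "pair_graph G" "set (labels t) = pverts G" "links t \<subseteq> parcs G"
    and succ: "successively (\<lambda>u v. (u, v) \<in> parcs G) (leaf_list t)"
    and closing: "(last (leaf_list t), hd (leaf_list t)) \<in> parcs G"
  shows "\<exists>H. spanning (with_proj H) (with_proj G) \<and> halin_graph H"
proof (intro exI conjI)
  interpret G: pair_graph G by (rule G(1))
  let ?H = "add_leaf_cycle tree_graph rho"
  show "halin_graph ?H"
    unfolding halin_graph_def using hit_tree_graph card_tree_graph rotation_system_rho by blast
  have "(u, w) \<in> parcs G" if nl: "next_leaf tree_graph rho u w" for u w
  proof -
    obtain X Y where XY: "leaf_list t = X @ u # Y" "w = hd (Y @ X @ [u])"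
      using next_leaf_cyc[OF nl] by blast
    show ?thesis
    proof (cases Y)
      case Nil
      then show ?thesis using closing XY by (cases X) auto
    next
      case (Cons y Y')
      then show ?thesis using succ XY by (auto simp: successively_append_iff)
    qed
  qed
  then have sub: "parcs ?H \<subseteq> parcs G"
    using G(3) by (auto simp: add_leaf_cycle_def tree_graph_def intro: G.arcs_symmetric)
  have verts: "pverts ?H = pverts G" using G(2) by (simp add: add_leaf_cycle_def tree_graph_def)
  have "pair_wf_digraph ?H"
  proof
    fix e assume "e \<in> parcs ?H"
    then have "e \<in> parcs G" using sub by blast
    then show "fst e \<in> pverts ?H" "snd e \<in> pverts ?H"
      unfolding verts using G.arc_fst_in_verts G.arc_snd_in_verts by blast+
  qed
  then have "wf_digraph (with_proj ?H)" by (simp add: wf_digraph_wp_iff)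
  then show "spanning (with_proj ?H) (with_proj G)"
    using sub verts G.wf_digraph by (simp add: spanning_def subgraph_def compatible_def)
qed

end

section \<open>Caterpillars and ladders\<close>

context pair_graph
begin

abbreviation adj :: "'a \<Rightarrow> 'a \<Rightarrow> bool" where
  "adj u v \<equiv> (u, v) \<in> parcs G"

lemma adj_sym: "adj u v \<Longrightarrow> adj v u"
  by (rule arcs_symmetric)

definition spanning_halin_exists :: bool where
  "spanning_halin_exists \<longleftrightarrow> (\<exists>H. spanning (with_proj H) (with_proj G) \<and> halin_graph H)"

text \<open>An unfinished Halin graph that grows at its root: \<open>x\<close> is the current end of
  the spine, and the leaves form a path from \<open>z\<close> to \<open>u\<close> that is still to
  be closed. Later steps meet \<open>S\<close> only in these three vertices. The root may still have
  degree 2, since its next spine neighbour is missing.\<close>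

definition chain :: "'a set \<Rightarrow> 'a \<Rightarrow> 'a \<Rightarrow> 'a \<Rightarrow> bool" where
  "chain S x z u \<longleftrightarrow> (\<exists>t. distinct (labels t) \<and> set (labels t) = S \<and> links t \<subseteq> parcs G \<and>
    branching t \<and> successively adj (leaf_list t) \<and>
    root t = x \<and> hd (leaf_list t) = z \<and> last (leaf_list t) = u)"

lemma chain_members: "chain S x z u \<Longrightarrow> finite S \<and> x \<in> S \<and> z \<in> S \<and> u \<in> S"
  using set_leaf_list_subset leaf_list_nonempty hd_in_set last_in_set root_in_labels
  unfolding chain_def by (metis List.finite_set subsetD)

lemma chain_start:
  assumes "distinct [x, z, u]" "adj x z" "adj x u" "adj z u"
  shows "chain {x, z, u} x z u"
  unfolding chain_def using assms by (intro exI[of _ "Node x [Node z [], Node u []]"]) auto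

lemma chain_extend_right:
  assumes "chain S x z u" "y \<notin> S" "v \<notin> S" "y \<noteq> v" "adj y x" "adj y v" "adj u v"
  shows "chain (insert y (insert v S)) y z v"
proof -
  obtain t where t: "distinct (labels t)" "set (labels t) = S" "links t \<subseteq> parcs G" "branching t"
    "successively adj (leaf_list t)" "root t = x" "hd (leaf_list t) = z" "last (leaf_list t) = u"
    using assms(1) unfolding chain_def by blast
  then show ?thesis unfolding chain_def
    using assms leaf_list_nonempty[of t] by (intro exI[of _ "Node y [t, Node v []]"])
      (auto simp: successively_append_iff)
qed

text \<open>Extends the leaf path at both ends. All five edges can be cross edges; then
  \<open>z\<close> and \<open>u\<close> both change parts, and one vertex is taken from the part of
  \<open>y\<close> and two from the other.\<close>

lemma chain_extend_both:
  assumes "chain S x z u" "distinct [y, v, w]" "{y, v, w} \<inter> S = {}"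
    "adj y x" "adj y v" "adj y w" "adj u v" "adj w z"
  shows "chain ({y, v, w} \<union> S) y w v"
proof -
  obtain t where t: "distinct (labels t)" "set (labels t) = S" "links t \<subseteq> parcs G" "branching t"
    "successively adj (leaf_list t)" "root t = x" "hd (leaf_list t) = z" "last (leaf_list t) = u"
    using assms(1) unfolding chain_def by blast
  then show ?thesis unfolding chain_def
    using assms leaf_list_nonempty[of t] by (intro exI[of _ "Node y [Node w [], t, Node v []]"])
      (auto simp: successively_append_iff successively_Cons)
qed

text \<open>The step that absorbs surplus: in use, the edge between the leaves \<open>v\<close> and
  \<open>v'\<close> lies inside a part and the other edges run between the parts.\<close>

lemma chain_extend_double:
  assumes "chain S x z u" "distinct [y, v, v']" "{y, v, v'} \<inter> S = {}"
    "adj y x" "adj y v" "adj y v'" "adj u v" "adj v v'"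
  shows "chain ({y, v, v'} \<union> S) y z v'"
proof -
  obtain t where t: "distinct (labels t)" "set (labels t) = S" "links t \<subseteq> parcs G" "branching t"
    "successively adj (leaf_list t)" "root t = x" "hd (leaf_list t) = z" "last (leaf_list t) = u"
    using assms(1) unfolding chain_def by blast
  then show ?thesis unfolding chain_def
    using assms leaf_list_nonempty[of t] by (intro exI[of _ "Node y [t, Node v [], Node v' []]"])
      (auto simp: successively_append_iff)
qed

text \<open>The last spine vertex becomes the root, where three children make up for the absent
  parent, and the edge from \<open>v'\<close> to \<open>z\<close> closes the leaf cycle.\<close>

lemma chain_close:
  assumes "chain S x z u" "distinct [y, v, v']" "{y, v, v'} \<inter> S = {}"
    "adj y x" "adj y v" "adj y v'" "adj u v" "adj v v'" "adj v' z" "{y, v, v'} \<union> S = pverts G"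
  shows spanning_halin_exists
proof -
  obtain t where t: "distinct (labels t)" "set (labels t) = S" "links t \<subseteq> parcs G" "branching t"
    "successively adj (leaf_list t)" "root t = x" "hd (leaf_list t) = z" "last (leaf_list t) = u"
    using assms(1) unfolding chain_def by blast
  let ?t = "Node y [t, Node v [], Node v' []]"
  interpret plane_rtree ?t using t assms(2,3) by unfold_locales auto
  show ?thesis unfolding spanning_halin_exists_def
    using t assms leaf_list_nonempty[of t] by (intro spanning_halin)
      (auto simp: successively_append_iff pair_graph)
qed

lemma wheel:
  assumes "distinct (c # xs)" "set (c # xs) = pverts G" "length xs \<ge> 3"
    "successively adj xs" "adj (last xs) (hd xs)" "\<And>x. x \<in> set xs \<Longrightarrow> adj c x"
  shows spanning_halin_exists
proof -
  let ?t = "Node c (map (\<lambda>x. Node x []) xs)"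
  have [simp]: "concat (map (labels \<circ> (\<lambda>x. Node x [])) xs) = xs"
    "concat (map (leaf_list \<circ> (\<lambda>x. Node x [])) xs) = xs" for xs :: "'a list"
    by (induction xs) auto
  have leaf: "leaf_list ?t = xs" using assms(3) by auto
  interpret plane_rtree ?t using assms(1,3) by unfold_locales auto
  show ?thesis unfolding spanning_halin_exists_def
  proof (rule spanning_halin)
    show "successively adj (leaf_list ?t)" "(last (leaf_list ?t), hd (leaf_list ?t)) \<in> parcs G"
      unfolding leaf by (rule assms)+
  qed (use assms pair_graph in auto)
qed

text \<open>
  A ladder is a path in the graph on the rungs in which \<open>(a, b)\<close> and \<open>(a', b')\<close> are joined if
  \<open>a b'\<close> and \<open>a' b\<close> are edges: the spine of the tree then passes alternately through the first and
  the second component of the rungs, and the leaves are the other components.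
\<close>

definition rung_adj :: "'a \<times> 'a \<Rightarrow> 'a \<times> 'a \<Rightarrow> bool" where
  "rung_adj p q \<longleftrightarrow> adj (fst p) (snd q) \<and> adj (fst q) (snd p)"

text \<open>\<open>c\<close> tells whether the spine passes through the first component of the
  current rung. The cross edges of \<open>rung_adj\<close> attach the next spine vertex and the next
  leaf in exchanged components, so \<open>c\<close> flips at each rung and the parity of the path
  fixes its final value.\<close>

lemma chain_ladder:
  fixes ps :: "('a \<times> 'a) list"
  defines "side \<equiv> \<lambda>c (p :: 'a \<times> 'a). if c then fst p else snd p"
  assumes "chain S (side c p) z (side (\<not> c) p)" "successively rung_adj (p # ps)"
    "distinct (map fst ps @ map snd ps)" "set (map fst ps @ map snd ps) \<inter> S = {}"
    "\<And>q. q \<in> set ps \<Longrightarrow> adj (fst q) (snd q)" "even (length ps) \<longleftrightarrow> c = c'"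
  shows "chain (fst ` set ps \<union> snd ` set ps \<union> S) (side c' (last (p # ps))) z (side (\<not> c') (last (p # ps)))"
  using assms(2-)
proof (induction ps arbitrary: p c S)
  case (Cons q ps)
  have q: "adj (fst p) (snd q)" "adj (fst q) (snd p)" "adj (fst q) (snd q)"
    using Cons.prems by (auto simp: rung_adj_def)
  have new: "fst q \<notin> S" "snd q \<notin> S" "fst q \<noteq> snd q" using Cons.prems(3,4) by auto
  let ?y = "side (\<not> c) q" and ?v = "side c q"
  have "chain (insert ?y (insert ?v S)) ?y z ?v"
    using q new by (intro chain_extend_right[OF Cons.prems(1)])
      (auto simp: side_def intro: adj_sym split: if_splits)
  moreover have S': "insert ?y (insert ?v S) = {fst q, snd q} \<union> S" by (auto simp: side_def)
  ultimately have "chain ({fst q, snd q} \<union> S) (side (\<not> c) q) z (side (\<not> \<not> c) q)" by simp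
  then have "chain (fst ` set ps \<union> snd ` set ps \<union> ({fst q, snd q} \<union> S))
    (side c' (last (q # ps))) z (side (\<not> c') (last (q # ps)))"
    by (rule Cons.IH) (use Cons.prems in auto)
  moreover have "fst ` set ps \<union> snd ` set ps \<union> ({fst q, snd q} \<union> S) =
    fst ` set (q # ps) \<union> snd ` set (q # ps) \<union> S" by auto
  ultimately show ?case by simp
qed simp

end

text \<open>
  \<open>D\<close> consists of the typical vertices, which miss almost nothing on the other side. The numerical
  constants in this locale leave much slack; what matters is that the density \<open>1/25\<close> of the
  exceptional vertices exceeds a few times the density \<open>1/1000\<close> of all exceptions.
\<close>

locale near_bipartite = pair_graph G for G :: "'a pair_pre_digraph" +
  fixes A B D :: "'a set" and n :: nat
  assumes parts: "A \<union> B = pverts G" "A \<inter> B = {}"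
    and order: "card (pverts G) = n" "n \<ge> 10000"
    and good_A: "\<And>a. a \<in> A \<Longrightarrow> a \<in> D \<Longrightarrow> 1000 * card {b \<in> B. \<not> adj a b} \<le> n"
    and good_B: "\<And>b. b \<in> B \<Longrightarrow> b \<in> D \<Longrightarrow> 1000 * card {a \<in> A. \<not> adj b a} \<le> n"
    and few_bad: "1000 * card (pverts G - D) \<le> n"
    and cross_A: "\<And>a. a \<in> A \<Longrightarrow> n \<le> 25 * card {b \<in> B. adj a b}"
    and cross_B: "\<And>b. b \<in> B \<Longrightarrow> n \<le> 25 * card {a \<in> A. adj b a}"
begin

lemma swapped: "near_bipartite G B A D n"
  using parts order good_A good_B few_bad cross_A cross_B
  by unfold_locales auto

lemma finite_parts: "finite A" "finite B"
  using parts pair_finite_verts by (metis finite_Un)+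

text \<open>The greedy choice behind all later constructions: vertices outside \<open>D\<close>,
  used vertices and the non-neighbours of two typical vertices together number at most n/1000 +
  n/200 + 2n/1000, which is less than n/30.\<close>

lemma pick_A:
  assumes X: "X \<subseteq> A" "n \<le> 30 * card X" and U: "finite U" "200 * card U \<le> n"
    and gs: "gs \<subseteq> B \<inter> D" "finite gs" "card gs \<le> 2"
  shows "\<exists>a \<in> X. a \<in> D \<and> a \<notin> U \<and> (\<forall>g \<in> gs. adj a g)"
proof (rule ccontr)
  assume "\<not> ?thesis"
  then have "X \<subseteq> (pverts G - D) \<union> U \<union> (\<Union>g \<in> gs. {a \<in> A. \<not> adj g a})"
    using X(1) parts(1) by (blast dest: adj_sym)
  moreover have fin: "finite (pverts G - D)" using pair_finite_verts by simp
  ultimately have "card X \<le> card ((pverts G - D) \<union> U \<union> (\<Union>g \<in> gs. {a \<in> A. \<not> adj g a}))"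
    using U gs finite_parts by (intro card_mono) auto
  also have "\<dots> \<le> card (pverts G - D) + card U + card (\<Union>g \<in> gs. {a \<in> A. \<not> adj g a})"
    by (meson card_Un_le add_le_mono le_trans order_refl)
  also have "card (\<Union>g \<in> gs. {a \<in> A. \<not> adj g a}) \<le> (\<Sum>g \<in> gs. card {a \<in> A. \<not> adj g a})"
    using gs(2) by (rule card_UN_le)
  finally have "1000 * card X \<le> 1000 * card (pverts G - D) + 1000 * card U
      + (\<Sum>g \<in> gs. 1000 * card {a \<in> A. \<not> adj g a})"
    by (simp add: sum_distrib_left[symmetric])
  also have "(\<Sum>g \<in> gs. 1000 * card {a \<in> A. \<not> adj g a}) \<le> card gs * n"
    using gs(1) good_B by (intro sum_bounded_above[where K = n, simplified]) auto
  also have "\<dots> \<le> 2 * n" using gs(3) by simp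
  finally show False using X(2) U(2) few_bad order by linarith
qed

lemma cross_pick_A: "b \<in> B \<Longrightarrow> n \<le> 30 * card {a \<in> A. adj b a}"
  using cross_B[of b] by linarith

text \<open>The typical vertex \<open>b\<close> loses at most n/1000 of the at least n/25 cross
  neighbours of \<open>b'\<close>.\<close>

lemma common_pick_A:
  assumes "b \<in> B" "b \<in> D" "b' \<in> B"
  shows "n \<le> 30 * card {a \<in> A. adj b a \<and> adj b' a}"
proof -
  have "card {a \<in> A. adj b' a} \<le> card ({a \<in> A. adj b a \<and> adj b' a} \<union> {a \<in> A. \<not> adj b a})"
    using finite_parts by (intro card_mono) auto
  also have "\<dots> \<le> card {a \<in> A. adj b a \<and> adj b' a} + card {a \<in> A. \<not> adj b a}"
    by (rule card_Un_le)
  finally show ?thesis using cross_B[OF assms(3)] good_B[OF assms(1,2)] by linarith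
qed

end

section \<open>Completing a ladder\<close>

lemma card_restrict_le:
  assumes "finite B" "finite U"
  shows "card {b \<in> B. P b} \<le> card {b \<in> B - U. P b \<and> Q b} + card U + card {b \<in> B. \<not> Q b}"
proof -
  have "card {b \<in> B. P b} \<le> card ({b \<in> B - U. P b \<and> Q b} \<union> U \<union> {b \<in> B. \<not> Q b})"
    using assms by (intro card_mono) auto
  also have "\<dots> \<le> card {b \<in> B - U. P b \<and> Q b} + card U + card {b \<in> B. \<not> Q b}"
    by (meson card_Un_le add_le_mono le_trans order_refl)
  finally show ?thesis .
qed

context near_bipartite
begin

lemma card_bad: "X \<subseteq> pverts G \<Longrightarrow> 1000 * card (X - D) \<le> n"
  using few_bad card_mono[of "pverts G - D" "X - D"] pair_finite_verts by fastforce

text \<open>The demand for a typical endpoint is made part of the relation handed to the exchange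
  lemma. It removes no neighbour of a typical vertex and at most n/1000 neighbours of an exceptional
  one.\<close>

lemma matching_of_rest:
  assumes A': "A' = A - U" and B': "B' = B - U" and eq: "card A' = card B'"
    and U: "finite U" "1000 * card U \<le> 10 * n"
  shows "\<exists>f. bij_betw f A' B' \<and> (\<forall>a \<in> A'. adj a (f a) \<and> (a \<in> D \<or> f a \<in> D))"
proof -
  have sub: "A' \<subseteq> pverts G" "B' \<subseteq> pverts G" using A' B' parts by auto
  have fin: "finite A'" "finite B'" using A' B' finite_parts by auto
  have "{b \<in> B. b \<notin> D} = B - D" "{a \<in> A. a \<notin> D} = A - D" by auto
  then have bad: "1000 * card {b \<in> B. \<not> b \<in> D} \<le> n" "1000 * card {a \<in> A. \<not> a \<in> D} \<le> n"
    using card_bad parts by auto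
  show ?thesis
  proof (rule bijection_by_swaps[where EA = "A' - D" and EB = "B' - D" and k = "n div 1000"])
    fix a assume a: "a \<in> A'"
    show "n div 1000 + card (A' - D) < card {b \<in> B'. adj a b \<and> (a \<in> D \<or> b \<in> D)}"
    proof -
      have "card {b \<in> B'. adj a b \<and> b \<in> D} \<le> card {b \<in> B'. adj a b \<and> (a \<in> D \<or> b \<in> D)}"
        using fin by (intro card_mono) auto
      then show ?thesis
        using card_restrict_le[OF finite_parts(2) U(1), of "adj a" "\<lambda>b. b \<in> D"] cross_A[of a]
          bad(1) card_bad[OF sub(1)] a A' U(2) order(2) unfolding B' by simp
    qed
    show "card {b \<in> B'. \<not> (adj a b \<and> (a \<in> D \<or> b \<in> D))} \<le> n div 1000" if "a \<notin> A' - D"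
    proof -
      have "card {b \<in> B'. \<not> (adj a b \<and> (a \<in> D \<or> b \<in> D))} \<le> card {b \<in> B. \<not> adj a b}"
        using a that B' finite_parts by (intro card_mono) auto
      then show ?thesis using good_A[of a] a that A' by simp
    qed
  next
    fix b assume b: "b \<in> B'"
    show "n div 1000 < card {a \<in> A'. adj a b \<and> (a \<in> D \<or> b \<in> D)}"
    proof -
      have "card {a \<in> A'. adj b a \<and> a \<in> D} \<le> card {a \<in> A'. adj a b \<and> (a \<in> D \<or> b \<in> D)}"
        using fin adj_sym by (intro card_mono) auto
      then show ?thesis
        using card_restrict_le[OF finite_parts(1) U(1), of "adj b" "\<lambda>b. b \<in> D"] cross_B[of b]
          bad(2) b B' U(2) order(2) unfolding A' by simp
    qed
    show "card {a \<in> A'. \<not> (adj a b \<and> (a \<in> D \<or> b \<in> D))} \<le> n div 1000" if "b \<notin> B' - D"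
    proof -
      have "card {a \<in> A'. \<not> (adj a b \<and> (a \<in> D \<or> b \<in> D))} \<le> card {a \<in> A. \<not> adj b a}"
        using b that A' finite_parts adj_sym by (intro card_mono) auto
      then show ?thesis using good_B[of b] b that B' by simp
    qed
  qed (use fin eq in auto)
qed

text \<open>A rung of two typical vertices misses at most 2n/1000 rungs, which gives
  \<open>n div 500\<close>. Otherwise the exceptional component still allows about n/25 rungs, less
  \<open>card U\<close>, and the typical component excludes at most n/1000 of them.\<close>

lemma rung_path:
  assumes X: "fst ` X \<subseteq> A" "snd ` X \<subseteq> B" "inj_on fst X" "inj_on snd X"
    "A \<subseteq> fst ` X \<union> U" "B \<subseteq> snd ` X \<union> U"
    and good: "\<And>p. p \<in> X \<Longrightarrow> fst p \<in> D \<or> snd p \<in> D"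
    and U: "finite U" "1000 * card U \<le> 10 * n" and st: "s \<in> X" "t \<in> X" "s \<noteq> t"
  shows "\<exists>xs. distinct xs \<and> set xs = X \<and> hd xs = s \<and> last xs = t \<and> successively rung_adj xs"
proof -
  have finX: "finite X" using X(1,3) finite_parts by (meson finite_imageD finite_subset)
  define E where "E = {p \<in> X. fst p \<notin> D} \<union> {p \<in> X. snd p \<notin> D}"
  have fst_le: "card {p \<in> X. P (fst p)} \<le> card {a \<in> A. P a}" for P
    using X finite_parts by (intro card_inj_on_le[of fst]) (auto simp: inj_on_def)
  have snd_le: "card {p \<in> X. P (snd p)} \<le> card {b \<in> B. P b}" for P
    using X finite_parts by (intro card_inj_on_le[of snd]) (auto simp: inj_on_def)
  have fst_ge: "card {a \<in> A. P a} \<le> card {p \<in> X. P (fst p)} + card U" for P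
  proof -
    have "card {a \<in> A. P a} \<le> card (fst ` {p \<in> X. P (fst p)} \<union> U)"
      using X finX U by (intro card_mono) auto
    also have "\<dots> \<le> card (fst ` {p \<in> X. P (fst p)}) + card U" by (rule card_Un_le)
    also have "card (fst ` {p \<in> X. P (fst p)}) = card {p \<in> X. P (fst p)}"
      using X(3) by (intro card_image) (auto simp: inj_on_def)
    finally show ?thesis .
  qed
  have snd_ge: "card {b \<in> B. P b} \<le> card {p \<in> X. P (snd p)} + card U" for P
  proof -
    have "card {b \<in> B. P b} \<le> card (snd ` {p \<in> X. P (snd p)} \<union> U)"
      using X finX U by (intro card_mono) auto
    also have "\<dots> \<le> card (snd ` {p \<in> X. P (snd p)}) + card U" by (rule card_Un_le)
    also have "card (snd ` {p \<in> X. P (snd p)}) = card {p \<in> X. P (snd p)}"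
      using X(4) by (intro card_image) (auto simp: inj_on_def)
    finally show ?thesis .
  qed
  have "{b \<in> B. b \<notin> D} = B - D" "{a \<in> A. a \<notin> D} = A - D" by auto
  then have bad: "1000 * card {b \<in> B. b \<notin> D} \<le> n" "1000 * card {a \<in> A. a \<notin> D} \<le> n"
    using card_bad parts by auto
  have E: "500 * card E \<le> n"
    using card_Un_le[of "{p \<in> X. fst p \<notin> D}" "{p \<in> X. snd p \<notin> D}"]
      fst_le[of "\<lambda>a. a \<notin> D"] snd_le[of "\<lambda>b. b \<notin> D"] bad unfolding E_def by linarith
  have split: "card {q \<in> X. \<not> rung_adj p q} \<le>
      card {q \<in> X. \<not> adj (fst p) (snd q)} + card {q \<in> X. \<not> adj (snd p) (fst q)}" for p
  proof -
    have "card {q \<in> X. \<not> rung_adj p q} \<le>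
      card ({q \<in> X. \<not> adj (fst p) (snd q)} \<union> {q \<in> X. \<not> adj (snd p) (fst q)})"
      using finX by (intro card_mono) (auto simp: rung_adj_def intro: adj_sym)
    also have "\<dots> \<le> card {q \<in> X. \<not> adj (fst p) (snd q)} + card {q \<in> X. \<not> adj (snd p) (fst q)}"
      by (rule card_Un_le)
    finally show ?thesis .
  qed
  show ?thesis
  proof (rule hamilton_path_by_reversals[where E = E and k = "n div 500"])
    show "rung_adj p q \<Longrightarrow> rung_adj q p" for p q by (auto simp: rung_adj_def)
    fix p assume p: "p \<in> X"
    have pA: "fst p \<in> A" "snd p \<in> B" using p X by auto
    show "card {q \<in> X. \<not> rung_adj p q} \<le> n div 500" if "p \<notin> E"
    proof -
      have "fst p \<in> D" "snd p \<in> D" using that p by (auto simp: E_def)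
      then show ?thesis
        using split[of p] fst_le[of "\<lambda>a. \<not> adj (snd p) a"] snd_le[of "\<lambda>b. \<not> adj (fst p) b"]
          good_A[of "fst p"] good_B[of "snd p"] pA by simp
    qed
    show "n div 500 + card E + 2 < card {q \<in> X. rung_adj p q}"
    proof (cases "fst p \<in> D")
      case True
      have "card {q \<in> X. adj (snd p) (fst q)} \<le>
          card {q \<in> X. rung_adj p q} + card {q \<in> X. \<not> adj (fst p) (snd q)}"
        using card_restrict_le[OF finX, of "{}" "\<lambda>q. adj (snd p) (fst q)" "\<lambda>q. adj (fst p) (snd q)"]
        by (simp add: rung_adj_def conj_commute adj_sym) (smt (verit) Collect_cong adj_sym)
      then show ?thesis
        using fst_ge[of "adj (snd p)"] snd_le[of "\<lambda>b. \<not> adj (fst p) b"] cross_B[OF pA(2)]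
          good_A[OF pA(1) True] E U(2) order(2) by linarith
    next
      case False
      then have D: "snd p \<in> D" using good p by blast
      have "card {q \<in> X. adj (fst p) (snd q)} \<le>
          card {q \<in> X. rung_adj p q} + card {q \<in> X. \<not> adj (snd p) (fst q)}"
        using card_restrict_le[OF finX, of "{}" "\<lambda>q. adj (fst p) (snd q)" "\<lambda>q. adj (snd p) (fst q)"]
        by (simp add: rung_adj_def) (smt (verit) Collect_cong adj_sym)
      then show ?thesis
        using snd_ge[of "adj (fst p)"] fst_le[of "\<lambda>a. \<not> adj (snd p) a"] cross_A[OF pA(1)]
          good_B[OF pA(2) D] E U(2) order(2) by linarith
    qed
  qed (use finX st in \<open>auto simp: E_def\<close>)
qed

text \<open>The open end \<open>(x, u)\<close> of the chain and the pair \<open>(v, y)\<close> of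
  the closing piece act as first and last rung, so a single Hamilton path of rungs joins them. As
  \<open>y\<close> is a spine vertex in \<open>B\<close>, the spine must leave the rung before it in
  \<open>A\<close>, just as it starts at \<open>x\<close>; so the number of rungs in between,
  \<open>card (B - S) - 1\<close>, must be even. The closing piece takes two vertices of
  \<open>A\<close> and one of \<open>B\<close>, whence the difference 1 in
  \<open>size\<close>.\<close>

lemma finish_odd:
  assumes chain: "chain S x z u" "S \<subseteq> pverts G" "x \<in> A" "x \<in> D" "u \<in> B"
    and ends: "y \<in> B" "y \<in> D" "v \<in> A" "v' \<in> A" "v \<noteq> v'" "{y, v, v'} \<inter> S = {}"
      "adj y v" "adj y v'" "adj v v'" "adj v' z"
    and size: "card (A - S) = card (B - S) + 1" "odd (card (B - S))" "1000 * card S \<le> 4 * n"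
  shows spanning_halin_exists
proof -
  have S: "finite S" "x \<in> S" "u \<in> S" using chain_members[OF chain(1)] by auto
  define U where "U = S \<union> {y, v, v'}"
  define A' B' where "A' = A - U" and "B' = B - U"
  have U: "finite U" "card U \<le> card S + 3"
    using S card_Un_le[of S "{y, v, v'}"] card_insert_le_m1[of 3 "{v, v'}" y]
    by (auto simp: U_def card_insert_if split: if_splits)
  have disj: "A \<inter> B = {}" by (rule parts)
  have A'eq: "A' = A - S - {v, v'}" and B'eq: "B' = B - S - {y}"
    using ends disj by (auto simp: A'_def B'_def U_def)
  have cA: "card A' = card (A - S) - 2"
    unfolding A'eq using ends by (subst card_Diff_subset) auto
  have cB: "card B' = card (B - S) - 1"
    unfolding B'eq using ends by (subst card_Diff_subset) auto
  have "card A' = card B'" using cA cB size(1) by simp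
  then obtain f where f: "bij_betw f A' B'"
    "\<And>a. a \<in> A' \<Longrightarrow> adj a (f a) \<and> (a \<in> D \<or> f a \<in> D)"
    using matching_of_rest[OF A'_def B'_def _ U(1)] U(2) size(3) order(2) by auto
  have fimg: "f ` A' = B'" and finj: "inj_on f A'" using f(1) by (auto simp: bij_betw_def)
  define M where "M = (\<lambda>a. (a, f a)) ` A'"
  define X where "X = insert (x, u) (insert (v, y) M)"
  have M: "fst ` M = A'" "snd ` M = B'" by (auto simp: M_def fimg[symmetric] image_image)
  have injM: "inj_on fst M" "inj_on snd M" using finj by (auto simp: M_def inj_on_def)
  have ne: "x \<noteq> v" "u \<noteq> y" "x \<notin> A'" "v \<notin> A'" "u \<notin> B'" "y \<notin> B'"
    using S ends by (auto simp: A'_def B'_def U_def)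
  have "\<exists>xs. distinct xs \<and> set xs = X \<and> hd xs = (x, u) \<and> last xs = (v, y) \<and> successively rung_adj xs"
  proof (rule rung_path[where U = U])
    show "fst ` X \<subseteq> A" "snd ` X \<subseteq> B"
      using chain ends M by (auto simp: X_def A'_def B'_def)
    show "inj_on fst X" "inj_on snd X"
      using injM ne M unfolding X_def by (auto simp: inj_on_insert)
    show "A \<subseteq> fst ` X \<union> U" "B \<subseteq> snd ` X \<union> U"
      using M by (auto simp: X_def A'_def B'_def)
    show "fst p \<in> D \<or> snd p \<in> D" if "p \<in> X" for p
      using that chain(4) ends(2) by (auto simp: X_def M_def dest: f(2))
    show "1000 * card U \<le> 10 * n" using U(2) size(3) order(2) by simp
  qed (use U ne in \<open>auto simp: X_def\<close>)
  then obtain xs where xs: "distinct xs" "set xs = X" "hd xs = (x, u)" "last xs = (v, y)"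
    "successively rung_adj xs" by blast
  define ps where "ps = butlast (tl xs)"
  have "xs \<noteq> []" using xs(2) by (auto simp: X_def)
  then have "xs = (x, u) # tl xs" using xs(3) by (metis list.collapse)
  moreover have "tl xs \<noteq> []" using calculation xs(4) ne(1) by (metis Pair_inject last.simps)
  ultimately have eq: "xs = (x, u) # ps @ [(v, y)]"
    using xs(4) by (metis append_butlast_last_id last.simps ps_def)
  have "(x, u) \<notin> M" "(v, y) \<notin> M" using ne by (auto simp: M_def)
  then have setps: "set ps = M" using xs(1,2) unfolding eq X_def by auto
  have len: "length ps = card A'"
    using distinct_card[of ps] xs(1) card_image[OF injM(1)] M(1) unfolding eq by (simp add: setps)
  have succ: "successively rung_adj ((x, u) # ps)" "rung_adj (last ((x, u) # ps)) (v, y)"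
    using xs(5) eq successively_append_iff[of rung_adj "(x, u) # ps" "[(v, y)]"] by auto
  define q where "q = last ((x, u) # ps)"
  have dist: "distinct (map fst ps @ map snd ps)"
    using xs(1) injM M disj unfolding eq
    by (auto simp: distinct_map setps A'_def B'_def)
  have "set (map fst ps @ map snd ps) = A' \<union> B'" using M by (simp add: setps)
  then have fresh: "set (map fst ps @ map snd ps) \<inter> S = {}" by (auto simp: A'_def B'_def U_def)
  have rungs: "adj (fst p) (snd p)" if "p \<in> set ps" for p
    using that f(2) by (auto simp: setps M_def)
  have "even (length ps)" using len cA size by simp
  then have "chain (fst ` set ps \<union> snd ` set ps \<union> S) (fst q) z (snd q)"
    using chain_ladder[of S True "(x, u)" z ps True, OF _ succ(1) dist fresh rungs] chain(1)
    unfolding q_def by simp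
  then have final: "chain (A' \<union> B' \<union> S) (fst q) z (snd q)" by (simp add: setps M)
  show ?thesis
  proof (rule chain_close[OF final])
    show "distinct [y, v, v']" using ends disj by auto
    show "{y, v, v'} \<inter> (A' \<union> B' \<union> S) = {}" using ends by (auto simp: A'_def B'_def U_def)
    show "{y, v, v'} \<union> (A' \<union> B' \<union> S) = pverts G"
      using ends chain(2) parts(1) by (auto simp: A'_def B'_def U_def)
    show "adj y (fst q)" "adj (snd q) v" using succ(2) adj_sym by (auto simp: q_def rung_adj_def)
  qed (use ends in auto)
qed


lemma pick_B:
  assumes "X \<subseteq> B" "n \<le> 30 * card X" "finite U" "200 * card U \<le> n"
    and "gs \<subseteq> A \<inter> D" "finite gs" "card gs \<le> 2"
  shows "\<exists>b \<in> X. b \<in> D \<and> b \<notin> U \<and> (\<forall>g \<in> gs. adj b g)"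
  using near_bipartite.pick_A[OF swapped] assms by blast

lemma cross_pick_B: "a \<in> A \<Longrightarrow> n \<le> 30 * card {b \<in> B. adj a b}"
  using near_bipartite.cross_pick_A[OF swapped] by blast

text \<open>
  Closing the ladder requires \<open>odd (card (B - S))\<close>. The parity is switched by two spine vertices that
  carry a leaf on either side of the ladder.
\<close>

lemma finish:
  assumes chain: "chain S x z u" "S \<subseteq> pverts G" "x \<in> A" "x \<in> D" "u \<in> B" "z \<in> B"
    and ends: "y \<in> B" "y \<in> D" "v \<in> A" "v' \<in> A" "v \<noteq> v'" "{y, v, v'} \<inter> S = {}"
      "adj y v" "adj y v'" "adj v v'" "adj v' z"
    and size: "card (A - S) = card (B - S) + 1" "1000 * card S \<le> 3 * n"
  shows spanning_halin_exists
proof (cases "odd (card (B - S))")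
  case True
  then show ?thesis using finish_odd[OF chain(1-5) ends] size by simp
next
  case False
  have S: "finite S" "x \<in> S" "u \<in> S" "z \<in> S" using chain_members[OF chain(1)] by auto
  have disj: "A \<inter> B = {}" by (rule parts)
  define U where "U = S \<union> {y, v, v'}"
  have U: "finite U" "card U \<le> card S + 3"
    using S card_Un_le[of S "{y, v, v'}"] card_insert_le_m1[of 3 "{v, v'}" y]
    by (auto simp: U_def card_insert_if split: if_splits)
  have cU: "200 * card U \<le> n" "\<And>a. 200 * card (insert a U) \<le> n"
    using U size(2) order(2) by (auto simp: card_insert_if)
  obtain w where w: "w \<in> A" "w \<in> D" "w \<notin> U" "adj z w"
    using pick_A[of "{a \<in> A. adj z a}" U "{}"] cross_pick_A[OF chain(6)] U cU by auto
  obtain v1 where v1: "v1 \<in> A" "v1 \<in> D" "v1 \<notin> insert w U" "adj u v1"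
    using pick_A[of "{a \<in> A. adj u a}" "insert w U" "{}"] cross_pick_A[OF chain(5)] U cU by auto
  have "card {w, v1} \<le> 2" by (simp add: card_insert_if)
  then obtain y1 where y1: "y1 \<in> B" "y1 \<in> D" "y1 \<notin> U" "adj x y1" "adj y1 w" "adj y1 v1"
    using pick_B[of "{b \<in> B. adj x b}" U "{w, v1}"] cross_pick_B[OF chain(3)] U cU w v1 by auto
  obtain w2 where w2: "w2 \<in> B" "w2 \<in> D" "w2 \<notin> insert y1 U" "adj v' w2" "adj w2 w"
    using pick_B[of "{b \<in> B. adj v' b}" "insert y1 U" "{w}"] cross_pick_B[OF ends(4)] U cU w by auto
  have cU2: "200 * card (insert y1 (insert w2 U)) \<le> n" "200 * card (insert w (insert v1 U)) \<le> n"
    using U size(2) order(2) by (auto simp: card_insert_if)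
  obtain v2 where v2: "v2 \<in> B" "v2 \<in> D" "v2 \<notin> insert y1 (insert w2 U)" "adj v1 v2"
    using pick_B[of "{b \<in> B. adj v1 b}" "insert y1 (insert w2 U)" "{}"]
      cross_pick_B[OF v1(1)] U cU2 by auto
  have "card {w2, v2} \<le> 2" by (simp add: card_insert_if)
  then obtain y2 where y2: "y2 \<in> A" "y2 \<in> D" "y2 \<notin> insert w (insert v1 U)" "adj y1 y2"
      "adj y2 w2" "adj y2 v2"
    using pick_A[of "{a \<in> A. adj y1 a}" "insert w (insert v1 U)" "{w2, v2}"]
      cross_pick_A[OF y1(1)] U cU2 w2 v2 by auto
  \<comment> \<open>\<open>y1\<close> in \<open>B\<close> takes two leaves in \<open>A\<close>, then
    \<open>y2\<close> in \<open>A\<close> takes two in \<open>B\<close>. Each part loses three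
    vertices: the difference is kept and the parity flips. The new first leaf \<open>w2\<close> is
    again in \<open>B\<close> and was chosen adjacent to \<open>v'\<close>.\<close>
  have "chain ({y1, v1, w} \<union> S) y1 w v1"
    using w v1 y1 disj by (intro chain_extend_both[OF chain(1)]) (auto simp: U_def intro: adj_sym)
  then have "chain ({y2, v2, w2} \<union> ({y1, v1, w} \<union> S)) y2 w2 v2"
    by (rule chain_extend_both)
      (use w v1 y1 w2 v2 y2 disj in \<open>auto simp: U_def intro: adj_sym\<close>)
  moreover have "{y2, v2, w2} \<union> ({y1, v1, w} \<union> S) = S \<union> ({y2, v1, w} \<union> {y1, v2, w2})"
    by auto
  ultimately have chain': "chain (S \<union> ({y2, v1, w} \<union> {y1, v2, w2})) y2 w2 v2" by simp
  have "A - (S \<union> ({y2, v1, w} \<union> {y1, v2, w2})) = (A - S) - {y2, v1, w}"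
    using y1 v2 w2 disj by auto
  moreover have "card ((A - S) - {y2, v1, w}) = card (A - S) - 3"
    using w v1 y2 by (subst card_Diff_subset) (auto simp: U_def card_insert_if)
  moreover have "card {y2, v1, w} \<le> card (A - S)"
    using w v1 y2 finite_parts by (intro card_mono) (auto simp: U_def)
  moreover have "B - (S \<union> ({y2, v1, w} \<union> {y1, v2, w2})) = (B - S) - {y1, v2, w2}"
    using w v1 y2 disj by auto
  moreover have "card ((B - S) - {y1, v2, w2}) = card (B - S) - 3"
    using y1 v2 w2 by (subst card_Diff_subset) (auto simp: U_def card_insert_if)
  moreover have "card {y1, v2, w2} \<le> card (B - S)"
    using y1 v2 w2 finite_parts by (intro card_mono) (auto simp: U_def)
  moreover have "card {y2, v1, w} = 3" "card {y1, v2, w2} = 3"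
    using w v1 y2 y1 v2 w2 by (auto simp: card_insert_if)
  ultimately have cards: "card (A - (S \<union> ({y2, v1, w} \<union> {y1, v2, w2}))) = card (A - S) - 3"
    "card (B - (S \<union> ({y2, v1, w} \<union> {y1, v2, w2}))) = card (B - S) - 3"
    "3 \<le> card (A - S)" "3 \<le> card (B - S)" by simp_all
  have "card (S \<union> ({y2, v1, w} \<union> {y1, v2, w2})) \<le> card S + (3 + 3)"
    using card_Un_le[of S "{y2, v1, w} \<union> {y1, v2, w2}"] card_Un_le[of "{y2, v1, w}" "{y1, v2, w2}"]
      \<open>card {y2, v1, w} = 3\<close> \<open>card {y1, v2, w2} = 3\<close> by linarith
  then have "1000 * card (S \<union> ({y2, v1, w} \<union> {y1, v2, w2})) \<le> 4 * n"
    using size(2) order(2) by linarith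
  moreover have "S \<union> ({y2, v1, w} \<union> {y1, v2, w2}) \<subseteq> pverts G"
    using chain(2) w v1 y1 w2 v2 y2 parts(1) by blast
  moreover have "{y, v, v'} \<inter> (S \<union> ({y2, v1, w} \<union> {y1, v2, w2})) = {}"
    using ends w v1 y1 w2 v2 y2 by (auto simp: U_def)
  ultimately show ?thesis
    using finish_odd[OF chain'] y2 v2 ends w2 cards size(1) False by auto
qed

text \<open>The two ends use edges in different parts, so their effects on the balance cancel. Since
  the leaf cycle needs an edge between \<open>z\<close> and \<open>v'\<close>, the edge inside
  \<open>A\<close> is chosen at a typical neighbour \<open>v'\<close> of \<open>z\<close>; this is
  where every vertex of \<open>A\<close> must have a neighbour in \<open>A\<close>.\<close>

lemma spanning_halin_balanced:
  assumes bal: "card A = card B"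
    and edge_A: "\<And>a. a \<in> A \<Longrightarrow> \<exists>a' \<in> A. adj a a'" and edge_B: "\<And>b. b \<in> B \<Longrightarrow> \<exists>b' \<in> B. adj b b'"
  shows spanning_halin_exists
proof -
  have disj: "A \<inter> B = {}" by (rule parts)
  have "A \<noteq> {}"
  proof
    assume "A = {}"
    then show False using bal parts order finite_parts by auto
  qed
  then obtain a0 where "a0 \<in> A" by blast
  then obtain u where u: "u \<in> B" "u \<in> D"
    using pick_B[of "{b \<in> B. adj a0 b}" "{}" "{}"] cross_pick_B by auto
  obtain z where z: "z \<in> B" "adj u z" using edge_B u by blast
  obtain v' where v': "v' \<in> A" "v' \<in> D" "adj z v'"
    using pick_A[of "{a \<in> A. adj z a}" "{}" "{}"] cross_pick_A[OF z(1)] by auto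
  obtain v where v: "v \<in> A" "adj v' v" using edge_A v' by blast
  have small: "200 * card {a, b} \<le> n" for a b :: 'a
    using order(2) by (auto simp: card_insert_if)
  obtain x where x: "x \<in> A" "x \<in> D" "x \<notin> {v, v'}" "adj z x" "adj x u"
    using pick_A[of "{a \<in> A. adj z a}" "{v, v'}" "{u}"] cross_pick_A[OF z(1)] small u by auto
  obtain y where y: "y \<in> B" "y \<in> D" "y \<notin> {z, u}" "adj v y" "adj y v'"
    using pick_B[of "{b \<in> B. adj v b}" "{z, u}" "{v'}"] cross_pick_B[OF v(1)] small v' by auto
  have ne: "z \<noteq> u" "v \<noteq> v'" using z v no_loops' by blast+
  have chain: "chain {x, z, u} x z u"
    using x z u disj ne by (intro chain_start) (auto intro: adj_sym)
  have "A - {x, z, u} = A - {x}" "B - {x, z, u} = B - {z, u}" using x z u disj by auto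
  moreover have "card (A - {x}) = card A - 1" using x finite_parts by simp
  moreover have "card (B - {z, u}) = card B - 2"
    using z u ne by (subst card_Diff_subset) (auto simp: card_insert_if)
  moreover have "card {z, u} \<le> card B" using z u finite_parts by (intro card_mono) auto
  moreover have "card {z, u} = 2" using ne by simp
  ultimately have size: "card (A - {x, z, u}) = card (B - {x, z, u}) + 1" using bal by simp
  have small3: "1000 * card {x, z, u} \<le> 3 * n" using order(2) by (auto simp: card_insert_if)
  have notin: "{y, v, v'} \<inter> {x, z, u} = {}" using x y z u v v' disj by blast
  have adjs: "adj y v" "adj y v'" "adj v v'" "adj v' z" using y v v' adj_sym by blast+
  have sub: "{x, z, u} \<subseteq> pverts G" using x z u parts by blast
  show ?thesis
    by (rule finish[OF chain sub x(1,2) u(1) z(1) y(1,2) v(1) v'(1) ne(2) notin adjs size small3])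
qed

end

section \<open>Unbalanced bipartitions\<close>

context near_bipartite
begin

text \<open>Between two pairs of leaves in \<open>B\<close> the spine must pass through a vertex of
  \<open>B\<close>, whose leaf in \<open>A\<close> joins the old last leaf to the next pair. Each
  further edge thus takes two vertices of \<open>A\<close> and three of \<open>B\<close>, lowering
  the surplus by one. \<open>F\<close> protects vertices reserved for later.\<close>

lemma chain_of_doubles:
  assumes "es \<noteq> []" "set (map fst es @ map snd es) \<subseteq> B" "distinct (map fst es @ map snd es)"
    and "\<And>e. e \<in> set es \<Longrightarrow> adj (fst e) (snd e)"
    and "\<And>p q. p \<in> set (map fst es @ map snd es) \<Longrightarrow> q \<in> set (map fst es @ map snd es) \<Longrightarrow>
      n \<le> 30 * card {a \<in> A. adj p a \<and> adj q a}"
    and "finite F" "F \<inter> set (map fst es @ map snd es) = {}" "200 * (card F + 5 * length es) \<le> n"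
  shows "\<exists>S x. chain S x (fst (hd es)) (snd (last es)) \<and> x \<in> A \<and> x \<in> D \<and> S \<subseteq> pverts G \<and>
    S \<inter> F = {} \<and> card (S \<inter> A) + 1 = 2 * length es \<and> card (S \<inter> B) + 1 = 3 * length es"
  using assms
proof (induction es arbitrary: F rule: rev_induct)
  case (snoc e es)
  obtain p q where e: "e = (p, q)" by (cases e)
  have disj: "A \<inter> B = {}" by (rule parts)
  have pq: "p \<in> B" "q \<in> B" "adj p q" "p \<noteq> q" "p \<notin> F" "q \<notin> F"
    using snoc.prems(2,3,7) snoc.prems(4)[of e] e by auto
  have common: "n \<le> 30 * card {a \<in> A. adj p a \<and> adj q a}"
    using snoc.prems(5)[of p q] e by simp
  show ?case
  proof (cases "es = []")
    case True
    have "200 * card F \<le> n" using snoc.prems(8) by simp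
    then obtain x where x: "x \<in> A" "x \<in> D" "x \<notin> F" "adj p x" "adj q x"
      using pick_A[of "{a \<in> A. adj p a \<and> adj q a}" F "{}"] common snoc.prems(6) by auto
    have "chain {x, p, q} x p q"
      using x pq disj by (intro chain_start) (auto intro: adj_sym)
    moreover have "{x, p, q} \<inter> A = {x}" "{x, p, q} \<inter> B = {p, q}" using x pq disj by auto
    then have "card ({x, p, q} \<inter> A) = 1" "card ({x, p, q} \<inter> B) = 2" using pq(4) by simp_all
    moreover have "{x, p, q} \<subseteq> pverts G" "{x, p, q} \<inter> F = {}" using x pq parts by auto
    ultimately show ?thesis using True e x
      by (intro exI[of _ "{x, p, q}"] exI[of _ x]) (simp del: Int_insert_left Int_insert_right)
  next
    case False
    let ?W = "set (map fst es @ map snd es)"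
    have pqW: "p \<notin> ?W" "q \<notin> ?W" using snoc.prems(3) e by auto
    have "card (insert p (insert q F)) \<le> card F + 2"
      using snoc.prems(6) by (auto simp: card_insert_if)
    \<comment> \<open>Reserving the removed edge adds 2 to \<open>F\<close>, while the shorter list
      frees 5.\<close>
    then have "200 * (card (insert p (insert q F)) + 5 * length es) \<le> n" using snoc.prems(8) by simp
    moreover have "insert p (insert q F) \<inter> ?W = {}"
      using pqW snoc.prems(7) by auto
    ultimately obtain S x where S: "chain S x (fst (hd es)) (snd (last es))" "x \<in> A" "x \<in> D"
      "S \<subseteq> pverts G" "S \<inter> insert p (insert q F) = {}"
      "card (S \<inter> A) + 1 = 2 * length es" "card (S \<inter> B) + 1 = 3 * length es"
      using snoc.IH[of "insert p (insert q F)"] False snoc.prems(2-6) by auto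
    define u where "u = snd (last es)"
    have u: "u \<in> ?W" using False by (simp add: u_def)
    have memS: "finite S" "x \<in> S" "u \<in> S" using chain_members[OF S(1)] by (auto simp: u_def)
    have "S = (S \<inter> A) \<union> (S \<inter> B)" using S(4) parts(1) by blast
    then have "card S \<le> card (S \<inter> A) + card (S \<inter> B)" by (metis card_Un_le)
    then have cardS: "card S + 2 \<le> 5 * length es" using S(6,7) by linarith
    define U where "U = S \<union> F \<union> {p, q}"
    have finU: "finite U" using memS snoc.prems(6) by (simp add: U_def)
    have "card U \<le> card S + card F + 2"
      using card_Un_le[of "S \<union> F" "{p, q}"] card_Un_le[of S F] pq(4) by (simp add: U_def)
    then have cU: "200 * card U \<le> n" "\<And>a. 200 * card (insert a U) \<le> n"
      using cardS snoc.prems(8) finU by (auto simp: card_insert_if)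
    have "n \<le> 30 * card {a \<in> A. adj u a \<and> adj p a}"
      using snoc.prems(5)[of u p] u e by auto
    then obtain a where a: "a \<in> A" "a \<in> D" "a \<notin> U" "adj u a" "adj p a"
      using pick_A[of "{a \<in> A. adj u a \<and> adj p a}" U "{}"] finU cU by auto
    obtain b where b: "b \<in> B" "b \<in> D" "b \<notin> U" "adj x b" "adj b a"
      using pick_B[of "{b \<in> B. adj x b}" U "{a}"] cross_pick_B[OF S(2)] finU cU a by auto
    obtain y where y: "y \<in> A" "y \<in> D" "y \<notin> insert a U" "adj p y" "adj q y" "adj y b"
      using pick_A[of "{a \<in> A. adj p a \<and> adj q a}" "insert a U" "{b}"] common finU cU b by auto
    have "chain (insert b (insert a S)) b (fst (hd es)) a"
      using a b disj by (intro chain_extend_right[OF S(1)]) (auto simp: U_def u_def intro: adj_sym)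
    then have "chain ({y, p, q} \<union> insert b (insert a S)) y (fst (hd es)) q"
      using a b y pq disj S(5)
      by (intro chain_extend_double) (auto simp: U_def intro: adj_sym)
    moreover define T where "T = {y, p, q} \<union> insert b (insert a S)"
    ultimately have T: "chain T y (fst (hd es)) q" by simp
    have TA: "T \<inter> A = insert y (insert a (S \<inter> A))"
      using a b y pq disj by (auto simp: T_def)
    have TB: "T \<inter> B = insert p (insert q (insert b (S \<inter> B)))"
      using a b y pq disj by (auto simp: T_def)
    have "card (T \<inter> A) = card (S \<inter> A) + 2"
      unfolding TA using a y memS by (auto simp: U_def)
    moreover have "card (T \<inter> B) = card (S \<inter> B) + 3"
      unfolding TB using b pq memS S(5) by (auto simp: U_def)
    moreover have "T \<subseteq> pverts G" using a b y pq S(4) parts(1) by (auto simp: T_def)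
    moreover have "T \<inter> F = {}" using a b y pq S(5) by (auto simp: T_def U_def)
    ultimately show ?thesis
      using T S(6,7) y e False by (intro exI[of _ T] exI[of _ y]) simp
  qed
qed simp

text \<open>The edges of \<open>es\<close> absorb the surplus exactly, but leave a leaf path with
  both ends in \<open>B\<close>, where the closing leaf \<open>v'\<close> lies as well. The spine
  vertex \<open>y1\<close> with leaves \<open>w\<close> and \<open>v1\<close> moves both ends to
  \<open>A\<close> and creates the difference 1 that \<open>finish\<close> expects with the parts
  exchanged; \<open>w\<close> is chosen adjacent to \<open>v'\<close> for the closing edge.\<close>

lemma spanning_halin_unbalanced:
  assumes size: "card B = card A + length es" "es \<noteq> []" "10000 * length es \<le> n"
    and es: "set (map fst es @ map snd es) \<subseteq> B" "distinct (map fst es @ map snd es)"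
      "\<And>e. e \<in> set es \<Longrightarrow> adj (fst e) (snd e)"
      "\<And>p q. p \<in> set (map fst es @ map snd es) \<Longrightarrow> q \<in> set (map fst es @ map snd es) \<Longrightarrow>
        n \<le> 30 * card {a \<in> A. adj p a \<and> adj q a}"
    and v: "v \<in> B" "v' \<in> B" "adj v v'" "{v, v'} \<inter> set (map fst es @ map snd es) = {}"
      "n \<le> 30 * card {a \<in> A. adj v a \<and> adj v' a}"
      "n \<le> 30 * card {a \<in> A. adj (fst (hd es)) a \<and> adj v' a}"
  shows spanning_halin_exists
proof -
  have disj: "A \<inter> B = {}" by (rule parts)
  have ne: "v \<noteq> v'" using v(3) no_loops' by blast
  have "200 * (card {v, v'} + 5 * length es) \<le> n"
    using size(3) order(2) ne by simp
  then obtain S x where S: "chain S x (fst (hd es)) (snd (last es))" "x \<in> A" "x \<in> D"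
    "S \<subseteq> pverts G" "S \<inter> {v, v'} = {}"
    "card (S \<inter> A) + 1 = 2 * length es" "card (S \<inter> B) + 1 = 3 * length es"
    using chain_of_doubles[OF size(2) es, of "{v, v'}"] v(4) by auto
  define z u where "z = fst (hd es)" and "u = snd (last es)"
  have mem: "finite S" "x \<in> S" "z \<in> S" "u \<in> S" using chain_members[OF S(1)] by (auto simp: u_def z_def)
  have uB: "u \<in> B" using es(1) size(2) by (force simp: u_def)
  have "S = (S \<inter> A) \<union> (S \<inter> B)" using S(4) parts(1) by blast
  then have "card S \<le> card (S \<inter> A) + card (S \<inter> B)" by (metis card_Un_le)
  then have cardS: "card S + 2 \<le> 5 * length es" using S(6,7) by linarith
  have cS: "200 * card (insert a (insert b S)) \<le> n" "200 * card (insert a S) \<le> n" "200 * card S \<le> n" for a b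
    using cardS size(3) order(2) mem by (auto simp: card_insert_if)
  obtain w where w: "w \<in> A" "w \<in> D" "w \<notin> S" "adj z w" "adj v' w"
    using pick_A[of "{a \<in> A. adj z a \<and> adj v' a}" S "{}"] v(6) mem cS by (auto simp: z_def)
  obtain v1 where v1: "v1 \<in> A" "v1 \<in> D" "v1 \<notin> insert w S" "adj u v1"
    using pick_A[of "{a \<in> A. adj u a}" "insert w S" "{}"] cross_pick_A[OF uB] mem cS by auto
  have "card {w, v1} \<le> 2" by (simp add: card_insert_if)
  then obtain y1 where y1: "y1 \<in> B" "y1 \<in> D" "y1 \<notin> insert v (insert v' S)" "adj x y1" "adj y1 w" "adj y1 v1"
    using pick_B[of "{b \<in> B. adj x b}" "insert v (insert v' S)" "{w, v1}"] cross_pick_B[OF S(2)]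
      mem cS w v1 by auto
  obtain y where y: "y \<in> A" "y \<in> D" "y \<notin> insert w (insert v1 S)" "adj v y" "adj v' y"
    using pick_A[of "{a \<in> A. adj v a \<and> adj v' a}" "insert w (insert v1 S)" "{}"] v(5) mem cS by auto
  define T where "T = {y1, v1, w} \<union> S"
  have T: "chain T y1 w v1" unfolding T_def
    using w v1 y1 disj by (intro chain_extend_both[OF S(1)]) (auto simp: u_def z_def intro: adj_sym)
  have TA: "T \<inter> A = insert v1 (insert w (S \<inter> A))" using w v1 y1 disj by (auto simp: T_def)
  have TB: "T \<inter> B = insert y1 (S \<inter> B)" using w v1 y1 disj by (auto simp: T_def)
  have cTA: "card (T \<inter> A) = 2 * length es + 1" unfolding TA using w v1 mem S(6) by auto
  have cTB: "card (T \<inter> B) = 3 * length es" unfolding TB using y1 mem S(7) by auto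
  have "card (A - T) + card (T \<inter> A) = card A" "card (B - T) + card (T \<inter> B) = card B"
    using finite_parts by (metis Diff_Int_distrib2 Int_commute card_Diff_subset_Int card_mono
      finite_Int inf_le2 le_add_diff_inverse2)+
  then have sizes: "card (B - T) = card (A - T) + 1" using cTA cTB size(1) by simp
  have "card T \<le> card S + 3"
    using card_Un_le[of "{y1, v1, w}" S] by (simp add: T_def card_insert_if split: if_splits)
  then have small: "1000 * card T \<le> 3 * n" using cardS size(3) order(2) by simp
  have Tsub: "T \<subseteq> pverts G" using w v1 y1 S(4) parts by (auto simp: T_def)
  have notin: "{y, v, v'} \<inter> T = {}" using w v1 y1 y v(1,2) S(5) disj by (auto simp: T_def)
  show ?thesis
    using near_bipartite.finish[OF swapped T Tsub y1(1,2) v1(1) w(1) y(1,2) v(1,2) ne notin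
        _ _ v(3) _ sizes small] y w adj_sym by blast
qed

section \<open>Surplus one: two disjoint edges, stars and wheels\<close>

text \<open>Typical endpoints secure the required common neighbours: \<open>p\<close> for its pairs
  with \<open>q\<close> and \<open>v'\<close>, and \<open>v\<close> for its pair with
  \<open>v'\<close>.\<close>

lemma spanning_halin_two_good_edges:
  assumes size: "card B = card A + 1"
    and e: "p \<in> B" "q \<in> B" "adj p q" "p \<in> D" and e': "v \<in> B" "v' \<in> B" "adj v v'" "v \<in> D"
    and disj: "{p, q} \<inter> {v, v'} = {}"
  shows spanning_halin_exists
proof (rule spanning_halin_unbalanced[where es = "[(p, q)]" and v = v and v' = v'])
  have "p \<noteq> q" using e no_loops' by blast
  then show "distinct (map fst [(p, q)] @ map snd [(p, q)])" by simp
  have comm: "{a \<in> A. adj q a \<and> adj p a} = {a \<in> A. adj p a \<and> adj q a}" by auto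
  have pq: "n \<le> 30 * card {a \<in> A. adj p a \<and> adj q a}" by (rule common_pick_A[OF e(1,4,2)])
  moreover have pp: "n \<le> 30 * card {a \<in> A. adj p a \<and> adj p a}" by (rule common_pick_A[OF e(1,4,1)])
  moreover have qq: "n \<le> 30 * card {a \<in> A. adj q a \<and> adj q a}"
    using cross_pick_A[OF e(2)] by simp
  ultimately show "n \<le> 30 * card {a \<in> A. adj p' a \<and> adj q' a}"
    if "p' \<in> set (map fst [(p, q)] @ map snd [(p, q)])" "q' \<in> set (map fst [(p, q)] @ map snd [(p, q)])"
    for p' q'
    using that comm by auto
  show "n \<le> 30 * card {a \<in> A. adj v a \<and> adj v' a}" by (rule common_pick_A[OF e'(1,4,2)])
  show "n \<le> 30 * card {a \<in> A. adj (fst (hd [(p, q)])) a \<and> adj v' a}"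
    using common_pick_A[OF e(1,4) e'(2)] by simp
qed (use e e' size disj order(2) in auto)


lemma degree_split:
  "card {w \<in> pverts G. adj v w} = card {a \<in> A. adj v a} + card {b \<in> B. adj v b}"
proof -
  have "{w \<in> pverts G. adj v w} = {a \<in> A. adj v a} \<union> {b \<in> B. adj v b}" using parts by auto
  then show ?thesis using finite_parts parts by (simp add: card_Un_disjoint disjoint_iff)
qed

text \<open>A vertex outside \<open>D\<close> has many neighbours on its own side, two of which lie in \<open>D\<close>.\<close>

lemma spanning_halin_two_edges:
  assumes size: "card B = card A + 1"
    and deg: "\<And>b. b \<in> B \<Longrightarrow> card A + 1 \<le> card {w \<in> pverts G. adj b w}"
    and bad: "\<And>b. b \<in> B \<Longrightarrow> b \<notin> D \<Longrightarrow> n < 1000 * card {a \<in> A. \<not> adj b a}"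
    and edges: "p \<in> B" "q \<in> B" "adj p q" "v \<in> B" "v' \<in> B" "adj v v'" "{p, q} \<inter> {v, v'} = {}"
  shows spanning_halin_exists
proof (cases "\<exists>b \<in> B - D. \<exists>b' \<in> B - D. b \<noteq> b'")
  case True
  then obtain b b' where b: "b \<in> B" "b \<notin> D" "b' \<in> B" "b' \<notin> D" "b \<noteq> b'" by blast
  have good: "1 < card ({w \<in> B. adj d w} \<inter> D)" if d: "d \<in> B" "d \<notin> D" for d
  proof -
    have "card A = card {a \<in> A. adj d a} + card {a \<in> A. \<not> adj d a}"
      using finite_parts by (subst card_Un_disjoint[symmetric]) (auto intro: arg_cong[of _ _ card])
    moreover have "1000 * card (B - D) \<le> n"
      using few_bad card_mono[of "pverts G - D" "B - D"] parts pair_finite_verts by fastforce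
    moreover have "card {w \<in> B. adj d w} \<le> card ({w \<in> B. adj d w} \<inter> D) + card (B - D)"
    proof -
      have "card {w \<in> B. adj d w} \<le> card (({w \<in> B. adj d w} \<inter> D) \<union> (B - D))"
        using finite_parts by (intro card_mono) auto
      also have "\<dots> \<le> card ({w \<in> B. adj d w} \<inter> D) + card (B - D)" by (rule card_Un_le)
      finally show ?thesis .
    qed
    ultimately show ?thesis using bad[OF d] deg[OF d(1)] degree_split[of d] by linarith
  qed
  obtain g where g: "g \<in> B" "g \<in> D" "adj b g"
    using good[OF b(1,2)] by (metis (no_types, lifting) Int_iff card.empty ex_in_conv mem_Collect_eq not_less_zero)
  have "\<not> {w \<in> B. adj b' w} \<inter> D \<subseteq> {g}"
    using good[OF b(3,4)] card_mono[of "{g}" "{w \<in> B. adj b' w} \<inter> D"] by auto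
  then obtain g' where g': "g' \<in> B" "g' \<in> D" "adj b' g'" "g' \<noteq> g" by blast
  show ?thesis
    using spanning_halin_two_good_edges[OF size g(1) b(1) _ g(2) g'(1) b(3) _ g'(2)] g g' b adj_sym
    by blast
next
  case False
  \<comment> \<open>At most one vertex of \<open>B\<close> is exceptional in this case, so every
    edge inside \<open>B\<close> has a typical endpoint.\<close>
  then have "p \<in> D \<or> q \<in> D" "v \<in> D \<or> v' \<in> D" using edges no_loops' by blast+
  moreover have "adj q p" "adj v' v" using edges adj_sym by blast+
  ultimately show ?thesis
    using spanning_halin_two_good_edges[OF size, of p q v v'] spanning_halin_two_good_edges[OF size, of q p v v']
      spanning_halin_two_good_edges[OF size, of p q v' v] spanning_halin_two_good_edges[OF size, of q p v' v]
      edges by blast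
qed

end

context pair_graph
begin

text \<open>Pairwise intersecting edges form a star or a triangle, and four vertices without an
  isolated one exclude the triangle: two vertices outside an edge \<open>p q\<close> must be joined
  to the same end of it.\<close>

lemma star_if_no_disjoint_edges:
  assumes B: "finite B" "card B \<ge> 4" and edge: "\<And>b. b \<in> B \<Longrightarrow> \<exists>b' \<in> B. adj b b'"
    and no: "\<And>p q v v'. p \<in> B \<Longrightarrow> q \<in> B \<Longrightarrow> v \<in> B \<Longrightarrow> v' \<in> B \<Longrightarrow> adj p q \<Longrightarrow> adj v v' \<Longrightarrow>
      {p, q} \<inter> {v, v'} \<noteq> {}"
  shows "\<exists>c \<in> B. \<forall>b \<in> B. \<forall>b' \<in> B. adj b b' \<longrightarrow> b = c \<or> b' = c"
proof -
  have "B \<noteq> {}" using B(2) by auto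
  then obtain p q where pq: "p \<in> B" "q \<in> B" "adj p q" "p \<noteq> q" using edge no_loops' by blast
  have "card (B - {p, q}) \<ge> 2" using B pq by (simp add: card_Diff_subset)
  then have "\<exists>b1 \<in> B - {p, q}. \<exists>b2 \<in> B - {p, q}. b1 \<noteq> b2"
    by (metis card_le_Suc0_iff_eq not_less_eq_eq numeral_2_eq_2 B(1) finite_Diff)
  then obtain b1 b2 where b: "b1 \<in> B" "b2 \<in> B" "b1 \<notin> {p, q}" "b2 \<notin> {p, q}" "b1 \<noteq> b2" by blast
  have nbr: "b' \<in> {p, q}" if "b \<in> B" "b \<notin> {p, q}" "b' \<in> B" "adj b b'" for b b'
    using no[OF pq(1,2) that(1,3) pq(3) that(4)] that(2) by blast
  obtain c1 where c1: "c1 \<in> {p, q}" "adj b1 c1" using edge[OF b(1)] nbr[OF b(1,3)] by blast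
  have same: "b' = c1" if "b \<in> B" "b \<notin> {p, q}" "b' \<in> B" "adj b b'" "b \<noteq> b1" for b b'
    using no[OF b(1) _ that(1,3) c1(2) that(4)] nbr[OF that(1-4)] c1(1) that pq b(3) by blast
  have "b' = c1" if "b \<in> B" "b \<notin> {p, q}" "b' \<in> B" "adj b b'" for b b'
  proof (cases "b = b1")
    case True
    obtain c2 where c2: "c2 \<in> B" "adj b2 c2" using edge[OF b(2)] by blast
    have "c2 = c1" using same[OF b(2,4) c2] b(5) by simp
    then show ?thesis
      using no[OF b(1) that(3) b(2) c2(1) _ c2(2)] nbr[OF that] nbr[OF b(2,4) c2] that True b by blast
  qed (use same that in blast)
  then have "b = c1 \<or> b' = c1" if "b \<in> B" "b' \<in> B" "adj b b'" for b b'
    using that c1(1) adj_sym no_loops' by blast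
  moreover have "c1 \<in> B" using c1 pq by blast
  ultimately show ?thesis by blast
qed

lemma alternating_list:
  assumes "length as = length bs" "\<forall>a \<in> set as. \<forall>b \<in> set bs. adj a b"
  defines "xs \<equiv> splice as bs"
  shows "successively adj xs" and "set xs = set as \<union> set bs"
    and "distinct (as @ bs) \<Longrightarrow> distinct xs" and "length xs = 2 * length as"
    and "as \<noteq> [] \<Longrightarrow> hd xs = hd as \<and> last xs = last bs"
proof -
  have "successively adj xs \<and> set xs = set as \<union> set bs \<and> (distinct (as @ bs) \<longrightarrow> distinct xs) \<and>
    length xs = 2 * length as \<and> (as \<noteq> [] \<longrightarrow> hd xs = hd as \<and> last xs = last bs)"
    using assms(1,2) unfolding xs_def
  proof (induction as bs rule: list_induct2)
    case (Cons a as b bs)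
    have hd: "adj b (hd as)" if "as \<noteq> []" using Cons.prems that by (auto intro: adj_sym)
    have IH: "successively adj (splice as bs) \<and> set (splice as bs) = set as \<union> set bs \<and>
      (distinct (as @ bs) \<longrightarrow> distinct (splice as bs)) \<and> length (splice as bs) = 2 * length as \<and>
      (as \<noteq> [] \<longrightarrow> hd (splice as bs) = hd as \<and> last (splice as bs) = last bs)"
      using Cons by auto
    define ys where "ys = splice as bs"
    have "ys = [] \<longleftrightarrow> as = []" "bs = [] \<longleftrightarrow> as = []" using IH Cons.hyps by (auto simp: ys_def)
    then show ?case using IH Cons.prems hd unfolding ys_def[symmetric]
      by (auto simp: successively_Cons ys_def[symmetric])
  qed simp
  then show "successively adj xs" "set xs = set as \<union> set bs" "distinct (as @ bs) \<Longrightarrow> distinct xs"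
    "length xs = 2 * length as" "as \<noteq> [] \<Longrightarrow> hd xs = hd as \<and> last xs = last bs"
    by blast+
qed

end

context near_bipartite
begin

text \<open>
  Without two disjoint edges inside \<open>B\<close> these edges form a star, and moving its centre to the other
  side leaves a complete bipartite graph. If this happens on both sides, there is a spanning wheel.
\<close>

lemma odd_cases:
  assumes size: "card B = card A + 1"
    and deg: "\<And>b. b \<in> B \<Longrightarrow> card A + 1 \<le> card {w \<in> pverts G. adj b w}"
    and bad: "\<And>b. b \<in> B \<Longrightarrow> b \<notin> D \<Longrightarrow> n < 1000 * card {a \<in> A. \<not> adj b a}"
  shows "spanning_halin_exists \<or> (\<exists>c \<in> B. \<forall>b \<in> B - {c}. \<forall>a \<in> insert c A. adj b a)"
proof (cases "\<exists>p \<in> B. \<exists>q \<in> B. \<exists>v \<in> B. \<exists>v' \<in> B. adj p q \<and> adj v v' \<and> {p, q} \<inter> {v, v'} = {}")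
  case True
  then obtain p q v v' where "p \<in> B" "q \<in> B" "adj p q" "v \<in> B" "v' \<in> B" "adj v v'" "{p, q} \<inter> {v, v'} = {}"
    by blast
  then show ?thesis using spanning_halin_two_edges[OF size deg bad] by blast
next
  case False
  have le: "card {a \<in> A. adj b a} \<le> card A" for b using finite_parts by (intro card_mono) auto
  have edge: "\<exists>b' \<in> B. adj b b'" if "b \<in> B" for b
  proof -
    have "card {b' \<in> B. adj b b'} \<noteq> 0" using deg[OF that] degree_split[of b] le[of b] by linarith
    then show ?thesis by (metis (no_types, lifting) Collect_empty_eq card.empty)
  qed
  have "n = card A + card B"
    using order(1) parts finite_parts by (metis card_Un_disjoint)
  then have "card B \<ge> 4" using size order(2) by linarith
  moreover have "{p, q} \<inter> {v, v'} \<noteq> {}"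
    if "p \<in> B" "q \<in> B" "v \<in> B" "v' \<in> B" "adj p q" "adj v v'" for p q v v'
    using False that by blast
  ultimately have "\<exists>c \<in> B. \<forall>b \<in> B. \<forall>b' \<in> B. adj b b' \<longrightarrow> b = c \<or> b' = c"
    by (intro star_if_no_disjoint_edges[OF finite_parts(2) _ edge])
  then obtain c where c: "c \<in> B" "\<And>b b'. b \<in> B \<Longrightarrow> b' \<in> B \<Longrightarrow> adj b b' \<Longrightarrow> b = c \<or> b' = c"
    by blast
  have "adj b a" if b: "b \<in> B - {c}" and a: "a \<in> insert c A" for a b
  proof -
    \<comment> \<open>The neighbourhood of \<open>b\<close> is confined to a set whose size equals
      the degree bound, so it is that whole set.\<close>
    have "{w \<in> pverts G. adj b w} \<subseteq> insert c A" using c(2)[of b] b parts by auto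
    moreover have "c \<notin> A" using c(1) parts by blast
    then have "card (insert c A) = card A + 1" using finite_parts by simp
    ultimately have "{w \<in> pverts G. adj b w} = insert c A"
      using deg[of b] b finite_parts by (intro card_seteq) auto
    then show ?thesis using a by blast
  qed
  then show ?thesis using c(1) by blast
qed

lemma spanning_halin_odd:
  assumes size: "card B = card A + 1"
    and deg: "\<And>b. b \<in> pverts G \<Longrightarrow> card A + 1 \<le> card {w \<in> pverts G. adj b w}"
    and bad: "\<And>b. b \<in> B \<Longrightarrow> b \<notin> D \<Longrightarrow> n < 1000 * card {a \<in> A. \<not> adj b a}"
  shows spanning_halin_exists
proof -
  have BV: "B \<subseteq> pverts G" using parts by blast
  consider spanning_halin_exists | c where "c \<in> B" "\<And>b a. b \<in> B - {c} \<Longrightarrow> a \<in> insert c A \<Longrightarrow> adj b a"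
    using odd_cases[OF size deg bad] BV by blast
  then show ?thesis
  proof cases
    case 2
    define A1 B1 where "A1 = insert c A" and "B1 = B - {c}"
    have complete: "adj b a" "adj a b" if "b \<in> B1" "a \<in> A1" for a b
      using 2 that adj_sym by (auto simp: A1_def B1_def)
    have "c \<notin> A" using 2(1) parts by blast
    then have cards: "card A1 = card A + 1" "card B1 = card A"
      using 2(1) size finite_parts by (auto simp: A1_def B1_def)
    have n: "n = 2 * card A + 1"
      using order(1) parts finite_parts size by (metis card_Un_disjoint mult_2 add.assoc)
    have [simp]: "{b \<in> B1. adj a b} = B1" "{b \<in> B1. \<not> adj a b} = {}" if "a \<in> A1" for a
      using complete that by auto
    have [simp]: "{a \<in> A1. adj b a} = A1" "{a \<in> A1. \<not> adj b a} = {}" if "b \<in> B1" for b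
      using complete that by auto
    \<comment> \<open>With the centre moved, the graph between the parts is complete, so every
      vertex may count as typical. The parts are exchanged because \<open>A1\<close> is now the
      larger one.\<close>
    interpret N: near_bipartite G B1 A1 "pverts G" n
    proof
      show "B1 \<union> A1 = pverts G" "B1 \<inter> A1 = {}" using parts 2(1) by (auto simp: A1_def B1_def)
    qed (use order cards n in auto)
    have A1V: "A1 \<subseteq> pverts G" using N.parts by blast
    have "spanning_halin_exists \<or> (\<exists>c' \<in> A1. \<forall>a \<in> A1 - {c'}. \<forall>b \<in> insert c' B1. adj a b)"
    proof (rule N.odd_cases)
      show "card A1 = card B1 + 1" using cards by simp
      show "card B1 + 1 \<le> card {w \<in> pverts G. adj a w}" if "a \<in> A1" for a
        using deg[of a] cards(2) A1V that by auto
      show "n < 1000 * card {b \<in> B1. \<not> adj a b}" if "a \<in> A1" "a \<notin> pverts G" for a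
        using that A1V by blast
    qed
    then consider spanning_halin_exists
      | c' where "c' \<in> A1" "\<And>a b. a \<in> A1 - {c'} \<Longrightarrow> b \<in> insert c' B1 \<Longrightarrow> adj a b"
      by blast
    then show ?thesis
    proof cases
      \<comment> \<open>\<open>c'\<close> is joined to the rest of \<open>A1\<close> by the second
        star and to \<open>B1\<close> by completeness, so it can be the hub. The rim alternates
        between \<open>A1 - {c'}\<close> and \<open>B1\<close>, which have equal size.\<close>
      case (2 c')
      obtain as bs where as: "set as = A1 - {c'}" "distinct as" and bs: "set bs = B1" "distinct bs"
        using finite_distinct_list N.finite_parts by (metis finite_Diff)
      have len: "length as = card A" "length bs = card A"
        using distinct_card[OF as(2)] distinct_card[OF bs(2)] as bs cards 2(1) N.finite_parts by auto
      define xs where "xs = splice as bs"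
      have alt: "successively adj xs" "set xs = set as \<union> set bs"
        "distinct (as @ bs) \<Longrightarrow> distinct xs" "length xs = 2 * length as"
        "as \<noteq> [] \<Longrightarrow> hd xs = hd as \<and> last xs = last bs"
        unfolding xs_def using len complete(2) as(1) bs(1) by (intro alternating_list; auto)+
      have ne: "as \<noteq> []" "bs \<noteq> []" using len n order(2) by auto
      show ?thesis
      proof (rule wheel[of c' xs])
        show "distinct (c' # xs)" using alt as bs N.parts 2(1) by auto
        show "set (c' # xs) = pverts G" using alt(2) as bs N.parts 2(1) by auto
        show "length xs \<ge> 3" using alt(4) len n order(2) by simp
        show "adj (last xs) (hd xs)" 
          using alt(5) ne as(1) bs(1) complete(1)[of "last bs" "hd as"] hd_in_set last_in_set by auto
        show "adj c' x" if "x \<in> set xs" for x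
        proof (cases "x \<in> set as")
          case True
          then show ?thesis using 2(2)[of x c'] as(1) by (auto intro: adj_sym)
        next
          case False
          then show ?thesis using that alt(2) bs(1) complete(2)[of x c'] 2(1) by auto
        qed
      qed (rule alt)
    qed
  qed
qed

end

section \<open>Choosing the bipartition\<close>

lemma double_count_le:
  assumes "finite X" "finite Y" "\<And>x. x \<in> X \<Longrightarrow> l \<le> card {y \<in> Y. R x y}"
    and "\<And>y. y \<in> Y \<Longrightarrow> card {x \<in> X. R x y} \<le> m"
  shows "card X * l \<le> card Y * m"
proof -
  have "card X * l \<le> (\<Sum>x \<in> X. card {y \<in> Y. R x y})"
    using assms(3) sum_bounded_below[of X l "\<lambda>x. card {y \<in> Y. R x y}"] by simp
  also have "\<dots> = (\<Sum>y \<in> Y. card {x \<in> X. R x y})"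
    using sum.swap_restrict[OF assms(1,2), of "\<lambda>_ _. 1 :: nat" R] by simp
  also have "\<dots> \<le> card Y * m"
    using assms(4) sum_bounded_above[of Y "\<lambda>y. card {x \<in> X. R x y}" m] by simp
  finally show ?thesis .
qed

context pair_graph
begin

text \<open>Greedy choice: if at most \<open>k\<close> edges could not be extended, every edge
  inside \<open>B\<close> would meet their at most \<open>2 * k\<close> endpoints, and counting the
  edges from the other vertices into this set contradicts \<open>k\<close>.\<close>

lemma disjoint_edges:
  assumes B: "finite B" and deg: "\<And>b. b \<in> B \<Longrightarrow> r \<le> card {b' \<in> B. adj b b'}"
    "\<And>b. b \<in> B \<Longrightarrow> card {b' \<in> B. adj b b'} \<le> m"
    and k: "2 * k * m < (card B - 2 * k) * r"
  shows "\<exists>es. length es = Suc k \<and> set (map fst es @ map snd es) \<subseteq> B \<and>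
    distinct (map fst es @ map snd es) \<and> (\<forall>e \<in> set es. adj (fst e) (snd e))"
proof -
  have "j \<le> Suc k \<Longrightarrow> \<exists>es. length es = j \<and> set (map fst es @ map snd es) \<subseteq> B \<and>
    distinct (map fst es @ map snd es) \<and> (\<forall>e \<in> set es. adj (fst e) (snd e))" for j
  proof (induction j)
    case (Suc j)
    then obtain es where es: "length es = j" "set (map fst es @ map snd es) \<subseteq> B"
      "distinct (map fst es @ map snd es)" "\<forall>e \<in> set es. adj (fst e) (snd e)" by auto
    define W where "W = set (map fst es @ map snd es)"
    have W: "W \<subseteq> B" "finite W" "card W = 2 * j"
      using es(2) distinct_card[OF es(3)] es(1) by (auto simp: W_def)
    have "\<exists>b \<in> B - W. \<exists>b' \<in> B - W. adj b b'"
    proof (rule ccontr)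
      assume no: "\<not> ?thesis"
      have "card (B - W) * r \<le> card W * m"
      proof (rule double_count_le[where R = adj])
        fix b assume b: "b \<in> B - W"
        then have "{b' \<in> W. adj b b'} = {b' \<in> B. adj b b'}" using no W(1) by blast
        then show "r \<le> card {b' \<in> W. adj b b'}" using deg(1) b by simp
      next
        fix w assume w: "w \<in> W"
        have "card {b \<in> B - W. adj b w} \<le> card {b \<in> B. adj w b}"
          using B adj_sym by (intro card_mono) auto
        then show "card {b \<in> B - W. adj b w} \<le> m" using deg(2)[of w] w W(1) by auto
      qed (use B W in auto)
      then have "(card B - 2 * j) * r \<le> 2 * j * m" using W B by (simp add: card_Diff_subset)
      moreover have "2 * j * m \<le> 2 * k * m" using Suc.prems by simp
      moreover have "(card B - 2 * k) * r \<le> (card B - 2 * j) * r"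
        using Suc.prems by (intro mult_le_mono1) simp
      ultimately show False using k by linarith
    qed
    then obtain b b' where b: "b \<in> B - W" "b' \<in> B - W" "adj b b'" by blast
    moreover have "b \<noteq> b'" using b(3) no_loops' by blast
    ultimately show ?case using es by (intro exI[of _ "(b, b') # es"]) (auto simp: W_def)
  qed simp
  then show ?thesis by blast
qed

end

text \<open>The constants are stricter than in \<open>near_bipartite\<close>; the reserve is spent
  when up to n/20000 vertices change parts to correct the sizes.\<close>

locale rough_bipartite = pair_graph G for G :: "'a pair_pre_digraph" +
  fixes A B D :: "'a set" and n :: nat
  assumes parts: "A \<union> B = pverts G" "A \<inter> B = {}"
    and order: "card (pverts G) = n" "n \<ge> 10000"
    and min_deg: "\<And>v. v \<in> pverts G \<Longrightarrow> n + 1 \<le> 2 * card {w \<in> pverts G. adj v w}"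
    and good_A: "\<And>a. a \<in> A \<Longrightarrow> a \<in> D \<Longrightarrow> 1500 * card {b \<in> B. \<not> adj a b} \<le> n"
    and good_B: "\<And>b. b \<in> B \<Longrightarrow> b \<in> D \<Longrightarrow> 1500 * card {a \<in> A. \<not> adj b a} \<le> n"
    and few_bad: "10000 * card (pverts G - D) \<le> n"
    and cross_A: "\<And>a. a \<in> A \<Longrightarrow> n \<le> 12 * card {b \<in> B. adj a b}"
    and cross_B: "\<And>b. b \<in> B \<Longrightarrow> n \<le> 12 * card {a \<in> A. adj b a}"
    and sizes: "10000 * card A \<le> 10000 * card B + n" "10000 * card B \<le> 10000 * card A + n"
begin

lemma swapped: "rough_bipartite G B A D n"
  using parts order min_deg good_A good_B few_bad cross_A cross_B sizes
  by unfold_locales auto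

lemma finite_parts: "finite A" "finite B"
  using parts pair_finite_verts by (metis finite_Un)+

text \<open>The inner degree n/20 of a moved vertex becomes its cross degree. The new set of typical
  vertices is the largest admissible one, so a vertex outside it is known to miss more than n/1000
  of the other part, as the argument for surplus one requires.\<close>

lemma near_bipartite_move:
  assumes M: "M \<subseteq> B" "20000 * card M \<le> n" "\<And>b. b \<in> M \<Longrightarrow> n \<le> 20 * card {b' \<in> B. adj b b'}"
  defines "A' \<equiv> A \<union> M" and "B' \<equiv> B - M"
  shows "near_bipartite G A' B' {v. (v \<in> A' \<longrightarrow> 1000 * card {b \<in> B'. \<not> adj v b} \<le> n) \<and>
    (v \<in> B' \<longrightarrow> 1000 * card {a \<in> A'. \<not> adj v a} \<le> n)} n"
proof
  have fin: "finite A" "finite B" "finite M" using finite_parts M(1) finite_subset by auto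
  have finV: "finite (pverts G - D)" using pair_finite_verts by simp
  show "A' \<union> B' = pverts G" "A' \<inter> B' = {}" using parts M(1) by (auto simp: A'_def B'_def)
  define D' where "D' = {v. (v \<in> A' \<longrightarrow> 1000 * card {b \<in> B'. \<not> adj v b} \<le> n) \<and>
    (v \<in> B' \<longrightarrow> 1000 * card {a \<in> A'. \<not> adj v a} \<le> n)}"
  have "pverts G - D' \<subseteq> (pverts G - D) \<union> M"
  proof
    fix v assume v: "v \<in> pverts G - D'"
    show "v \<in> (pverts G - D) \<union> M"
    proof (rule ccontr)
      assume "\<not> ?thesis"
      then have vD: "v \<in> D" "v \<notin> M" using v by auto
      have "1000 * card {b \<in> B'. \<not> adj v b} \<le> n" if "v \<in> A'"
      proof -
        have "card {b \<in> B'. \<not> adj v b} \<le> card {b \<in> B. \<not> adj v b}"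
          using fin by (intro card_mono) (auto simp: B'_def)
        then show ?thesis using good_A[of v] that vD by (simp add: A'_def)
      qed
      moreover have "1000 * card {a \<in> A'. \<not> adj v a} \<le> n" if "v \<in> B'"
      proof -
        have "card {a \<in> A'. \<not> adj v a} \<le> card ({a \<in> A. \<not> adj v a} \<union> M)"
          using fin by (intro card_mono) (auto simp: A'_def)
        also have "\<dots> \<le> card {a \<in> A. \<not> adj v a} + card M" by (rule card_Un_le)
        finally show ?thesis using good_B[of v] that vD M(2) by (simp add: B'_def)
      qed
      ultimately show False using v by (auto simp: D'_def)
    qed
  qed
  then have "card (pverts G - D') \<le> card ((pverts G - D) \<union> M)"
    using finV fin by (intro card_mono) auto
  also have "\<dots> \<le> card (pverts G - D) + card M" by (rule card_Un_le)
  finally have "1000 * card (pverts G - D') \<le> n" using few_bad M(2) by simp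
  then show "1000 * card (pverts G - {v. (v \<in> A' \<longrightarrow> 1000 * card {b \<in> B'. \<not> adj v b} \<le> n) \<and>
    (v \<in> B' \<longrightarrow> 1000 * card {a \<in> A'. \<not> adj v a} \<le> n)}) \<le> n" by (simp add: D'_def)
  show "n \<le> 25 * card {b \<in> B'. adj a b}" if "a \<in> A'" for a
    using that cross_A[of a] M(2) M(3)[of a] card_restrict_le[OF fin(2,3), of "adj a" "\<lambda>_. True"] order(2)
    by (auto simp: A'_def B'_def)
  show "n \<le> 25 * card {a \<in> A'. adj b a}" if "b \<in> B'" for b
  proof -
    have "card {a \<in> A. adj b a} \<le> card {a \<in> A'. adj b a}"
      using fin by (intro card_mono) (auto simp: A'_def)
    then show ?thesis using cross_B[of b] that by (simp add: B'_def)
  qed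
qed (use order in auto)

text \<open>
  Moving a vertex from \<open>B\<close> to \<open>A\<close> decreases \<open>card B - card A\<close> by two. If there are not enough
  vertices of large degree inside \<open>B\<close> to bring the difference down to 0 or 1, the remaining vertices
  of \<open>B\<close> have small degree inside \<open>B\<close>, and then there are many disjoint edges inside \<open>B\<close>.
\<close>

lemma spanning_halin_le:
  assumes le: "card A \<le> card B"
  shows spanning_halin_exists
proof -
  define d where "d = card B - card A"
  define M where "M = {b \<in> B. n \<le> 20 * card {b' \<in> B. adj b b'}}"
  have d: "10000 * d \<le> n" "card B = card A + d" using sizes le by (auto simp: d_def)
  have n: "n = card A + card B" using order(1) parts finite_parts by (metis card_Un_disjoint)
  have inner: "n + 1 \<le> 2 * card {a \<in> X. adj v a} + 2 * card Y"
    if v: "v \<in> pverts G" and XY: "X \<union> Y = pverts G" "X \<inter> Y = {}" for v X Y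
  proof -
    have fin: "finite X" "finite Y" using XY(1) pair_finite_verts by (metis finite_Un)+
    have "card {w \<in> pverts G. adj v w} \<le> card ({a \<in> X. adj v a} \<union> Y)"
      using fin XY by (intro card_mono) auto
    also have "\<dots> \<le> card {a \<in> X. adj v a} + card Y" by (rule card_Un_le)
    finally show ?thesis using min_deg[OF v] by simp
  qed
  \<comment> \<open>Degrees exceed n/2, so at most n/2 vertices cannot hold all neighbours of
    \<open>v\<close>.\<close>
  have nbr: "\<exists>a \<in> X. adj v a"
    if v: "v \<in> pverts G" and XY: "X \<union> Y = pverts G" "X \<inter> Y = {}" "2 * card Y \<le> n" for v X Y
  proof -
    have "card {a \<in> X. adj v a} \<noteq> 0" using inner[OF v XY(1,2)] XY(3) by simp
    then show ?thesis by (metis (no_types, lifting) Collect_empty_eq card.empty)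
  qed
  show ?thesis
  proof (cases "d div 2 \<le> card M")
    case True
    then obtain M' where M': "M' \<subseteq> M" "card M' = d div 2" "finite M'"
      by (meson obtain_subset_with_card_n)
    have M'B: "M' \<subseteq> B" using M'(1) by (auto simp: M_def)
    have "20000 * card M' \<le> n" using M'(2) d(1) by simp
    then interpret N: near_bipartite G "A \<union> M'" "B - M'" "{v. (v \<in> A \<union> M' \<longrightarrow>
        1000 * card {b \<in> B - M'. \<not> adj v b} \<le> n) \<and>
        (v \<in> B - M' \<longrightarrow> 1000 * card {a \<in> A \<union> M'. \<not> adj v a} \<le> n)}" n
      using M'(1) by (intro near_bipartite_move[OF M'B]) (auto simp: M_def)
    have "A \<inter> M' = {}" using M'B parts by blast
    then have cards: "card (A \<union> M') = card A + d div 2" "card (B - M') = card B - d div 2"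
      using M' M'B finite_parts by (auto simp: card_Un_disjoint card_Diff_subset)
    have le': "d div 2 \<le> card B" using d(2) by simp
    show ?thesis
    proof (cases "even d")
      case True
      then have eq: "card (A \<union> M') = card (B - M')" using cards d(2) by auto
      then have half: "2 * card (A \<union> M') = n" "2 * card (B - M') = n"
        
        using n cards le' d(2) even_two_times_div_two[OF True] by linarith+
      show ?thesis
      proof (rule N.spanning_halin_balanced[OF eq])
        show "\<exists>a' \<in> A \<union> M'. adj a a'" if "a \<in> A \<union> M'" for a
          using nbr[of a "A \<union> M'" "B - M'"] that N.parts half by auto
        show "\<exists>b' \<in> B - M'. adj b b'" if "b \<in> B - M'" for b
          using nbr[of b "B - M'" "A \<union> M'"] that N.parts half by auto
      qed
    next
      case False
      then have eq: "card (B - M') = card (A \<union> M') + 1" using cards d(2) by presburger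
      have n': "n = 2 * card (A \<union> M') + 1" using eq n cards le' by simp
      show ?thesis
      proof (rule N.spanning_halin_odd[OF eq])
        show "card (A \<union> M') + 1 \<le> card {w \<in> pverts G. adj v w}" if "v \<in> pverts G" for v
          using min_deg[OF that] n' by simp
        show "n < 1000 * card {a \<in> A \<union> M'. \<not> adj b a}" if "b \<in> B - M'"
          "b \<notin> {v. (v \<in> A \<union> M' \<longrightarrow> 1000 * card {b \<in> B - M'. \<not> adj v b} \<le> n) \<and>
            (v \<in> B - M' \<longrightarrow> 1000 * card {a \<in> A \<union> M'. \<not> adj v a} \<le> n)}" for b
          using that N.parts(2) by auto
      qed
    qed
  next
    case False
    have MB: "M \<subseteq> B" by (auto simp: M_def)
    then have finM: "finite M" using finite_parts finite_subset by blast
    have "20000 * card M \<le> n" using False d(1) by simp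
    then interpret N: near_bipartite G "A \<union> M" "B - M" "{v. (v \<in> A \<union> M \<longrightarrow>
        1000 * card {b \<in> B - M. \<not> adj v b} \<le> n) \<and>
        (v \<in> B - M \<longrightarrow> 1000 * card {a \<in> A \<union> M. \<not> adj v a} \<le> n)}" n
      by (intro near_bipartite_move[OF MB]) (auto simp: M_def)
    \<comment> \<open>The surplus that remains when all of \<open>M\<close> has moved; it is at
      least 2 because \<open>card M\<close> stays below \<open>d div 2\<close>.\<close>
    define e where "e = d - 2 * card M"
    have "A \<inter> M = {}" using MB parts by blast
    then have cards: "card (A \<union> M) = card A + card M" "card (B - M) = card B - card M"
      using MB finM finite_parts by (auto simp: card_Un_disjoint card_Diff_subset)
    have size: "card (B - M) = card (A \<union> M) + e" "e \<ge> 2" "10000 * e \<le> n"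
      using cards d False by (auto simp: e_def)
    have n': "n = 2 * card (A \<union> M) + e" using n cards d(2) False by (simp add: e_def)
    have deg_le: "card {b' \<in> B - M. adj b b'} \<le> n div 20" if b: "b \<in> B - M" for b
    proof -
      have "card {b' \<in> B - M. adj b b'} \<le> card {b' \<in> B. adj b b'}"
        using finite_parts by (intro card_mono) auto
      moreover have "20 * card {b' \<in> B. adj b b'} < n" using b by (auto simp: M_def)
      ultimately show ?thesis by simp
    qed
    \<comment> \<open>Since n is twice the smaller part plus \<open>e\<close>, twice the inner
      degree is at least e + 1, and \<open>(e + 2) div 2\<close> is half of this rounded up.\<close>
    have deg_ge: "(e + 2) div 2 \<le> card {b' \<in> B - M. adj b b'}" if b: "b \<in> B - M" for b
    proof -
      have "n + 1 \<le> 2 * card {b' \<in> B - M. adj b b'} + 2 * card (A \<union> M)"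
        using b N.parts by (intro inner) auto
      then show ?thesis using n' by linarith
    qed
    have cross: "n + 1 \<le> 2 * card {a \<in> A \<union> M. adj b a} + 2 * (n div 20)" if b: "b \<in> B - M" for b
    proof -
      have "b \<in> pverts G" using b N.parts(1) by blast
      then show ?thesis using min_deg[of b] N.degree_split[of b] deg_le[OF b] by linarith
    qed
    \<comment> \<open>Both vertices have about 9n/20 neighbours in a part of fewer than n/2
      vertices, so they share about 2n/5, typical or not.\<close>
    have common: "n \<le> 30 * card {a \<in> A \<union> M. adj b a \<and> adj b' a}"
      if b: "b \<in> B - M" "b' \<in> B - M" for b b'
    proof -
      have "card {a \<in> A \<union> M. adj b a} + card {a \<in> A \<union> M. adj b' a} =
        card ({a \<in> A \<union> M. adj b a} \<union> {a \<in> A \<union> M. adj b' a}) +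
        card ({a \<in> A \<union> M. adj b a} \<inter> {a \<in> A \<union> M. adj b' a})"
        using N.finite_parts by (intro card_Un_Int) auto
      moreover have "card ({a \<in> A \<union> M. adj b a} \<union> {a \<in> A \<union> M. adj b' a}) \<le> card (A \<union> M)"
        using N.finite_parts by (intro card_mono) auto
      moreover have "{a \<in> A \<union> M. adj b a} \<inter> {a \<in> A \<union> M. adj b' a} =
        {a \<in> A \<union> M. adj b a \<and> adj b' a}" by auto
      ultimately have "card {a \<in> A \<union> M. adj b a} + card {a \<in> A \<union> M. adj b' a} \<le>
        card (A \<union> M) + card {a \<in> A \<union> M. adj b a \<and> adj b' a}" by simp
      then show ?thesis using cross[OF b(1)] cross[OF b(2)] n' by linarith
    qed
    \<comment> \<open>The inner degree bound grows with the number of edges wanted: the left side is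
      at most en/10, the right side at least (e + 1)n/5.\<close>
    have "2 * e * (n div 20) < (card (B - M) - 2 * e) * ((e + 2) div 2)"
    proof -
      define c r where "c = card (B - M) - 2 * e" and "r = (e + 2) div 2"
      have "10 * (2 * e * (n div 20)) \<le> e * n" by simp
      also have "e * n < (e + 1) * (2 * n)" using order(2) by simp
      also have "(e + 1) * (2 * n) \<le> (2 * r) * (5 * c)"
      proof (rule mult_le_mono)
        show "e + 1 \<le> 2 * r" unfolding r_def by presburger
        show "2 * n \<le> 5 * c" using size n' unfolding c_def by linarith
      qed
      also have "(2 * r) * (5 * c) = 10 * (c * r)" by simp
      finally show ?thesis unfolding c_def r_def by linarith
    qed
    then obtain es where es: "length es = Suc e" "set (map fst es @ map snd es) \<subseteq> B - M"
      "distinct (map fst es @ map snd es)" "\<forall>e \<in> set es. adj (fst e) (snd e)"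
      using disjoint_edges[OF N.finite_parts(2) deg_ge deg_le] by blast
    \<comment> \<open>Of the e + 1 edges one is set aside to close the leaf cycle.\<close>
    then obtain v v' es' where es': "es = (v, v') # es'"
      by (metis Suc_length_conv surj_pair)
    have ne: "es' \<noteq> []" using es(1) size(2) es' by auto
    then have hd: "fst (hd es') \<in> B - M" using es(2) es' by (cases es') auto
    show ?thesis
    proof (rule N.spanning_halin_unbalanced[where es = es' and v = v and v' = v'])
      show "set (map fst es' @ map snd es') \<subseteq> B - M" using es(2) es' by auto
      then show "n \<le> 30 * card {a \<in> A \<union> M. adj p a \<and> adj q a}"
        if "p \<in> set (map fst es' @ map snd es')" "q \<in> set (map fst es' @ map snd es')" for p q
        using common that by blast
    qed (use es es' ne size hd common in auto)
  qed
qed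

lemma spanning_halin: spanning_halin_exists
  using spanning_halin_le rough_bipartite.spanning_halin_le[OF swapped] by linarith

end


context pair_graph
begin

section \<open>From the sparse part to an almost complete bipartition\<close>

text \<open>Vertices of \<open>V1\<close> must send almost all their edges to \<open>V2\<close> and
  miss at most 8n/10^9 of it: 7 units come from the size of \<open>V2\<close>, 1 from the degree
  inside \<open>V1\<close>. Double counting bounds the set \<open>E\<close> of vertices of
  \<open>V2\<close> that miss much of \<open>V1\<close>. The worst of them form \<open>L\<close>;
  having few neighbours in \<open>V1\<close>, they have many in \<open>V2\<close> and change
  parts.\<close>

lemma rough_bipartite_exists:
  assumes V: "V1 \<union> V2 = pverts G" "V1 \<inter> V2 = {}" and n: "card (pverts G) = n" "n \<ge> 10000"
    and min_deg: "\<And>v. v \<in> pverts G \<Longrightarrow> n + 1 \<le> 2 * card {w \<in> pverts G. adj v w}"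
    and sparse: "\<And>v. v \<in> V1 \<Longrightarrow> 1000000000 * card {w \<in> V1. adj v w} \<le> n"
    and size: "1000000000 * n \<le> 2000000000 * card V1 + 14 * n"
  shows "\<exists>A B D. rough_bipartite G A B D n"
proof -
  have fin: "finite V1" "finite V2" using V(1) pair_finite_verts by (metis finite_Un)+
  have n_split: "card V1 + card V2 = n" using V n(1) fin by (metis card_Un_disjoint)
  have deg_split: "card {w \<in> pverts G. adj v w} = card {w \<in> V1. adj v w} + card {w \<in> V2. adj v w}" for v
  proof -
    have "{w \<in> pverts G. adj v w} = {w \<in> V1. adj v w} \<union> {w \<in> V2. adj v w}" using V(1) by auto
    then show ?thesis using fin V(2) by (simp add: card_Un_disjoint disjoint_iff)
  qed
  have compl: "card {w \<in> X. adj v w} + card {w \<in> X. \<not> adj v w} = card X" if "finite X" for v X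
    using that by (subst card_Un_disjoint[symmetric]) (auto intro: arg_cong[of _ _ card])
  have deg1: "n + 1 \<le> 2 * card {w \<in> V1. adj v w} + 2 * card {w \<in> V2. adj v w}" if "v \<in> pverts G" for v
    using min_deg[OF that] deg_split[of v] by simp
  have "V1 \<noteq> {}" using size n(2) by auto
  then obtain v0 where "v0 \<in> V1" by blast
  then have v0: "v0 \<in> V1" "v0 \<in> pverts G" using V(1) by auto
  \<comment> \<open>\<open>V2\<close> contains almost all of the more than n/2 neighbours of
    \<open>v0\<close>, so it is not much smaller than n/2.\<close>
  have "card {w \<in> V2. adj v0 w} \<le> card V2" using fin by (intro card_mono) auto
  then have size2: "1000000000 * n \<le> 2000000000 * card V2 + 2 * n"
    using deg1[OF v0(2)] sparse[OF v0(1)] by linarith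
  have miss1: "1000000000 * card {w \<in> V2. \<not> adj v w} \<le> 8 * n" if "v \<in> V1" for v
  proof -
    have "v \<in> pverts G" using that V(1) by blast
    then show ?thesis
      using deg1[of v] sparse[OF that] compl[OF fin(2), of v] size n_split by linarith
  qed
  define E where "E = {v \<in> V2. n < 2000 * card {a \<in> V1. \<not> adj v a}}"
  have finE: "finite E" using fin by (simp add: E_def)
  \<comment> \<open>Missing more than n/2000 vertices means missing at least
    \<open>n div 2000 + 1\<close>. With \<open>card V1\<close> at most n this yields the bound 2000
    times 8n/10^9, which is n/62500.\<close>
  have "card E * (n div 2000 + 1) \<le> card V1 * (8 * n div 1000000000)"
  proof (rule double_count_le[where R = "\<lambda>v a. \<not> adj v a"])
    show "n div 2000 + 1 \<le> card {a \<in> V1. \<not> adj v a}" if "v \<in> E" for v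
      using that by (simp add: E_def) linarith
    show "card {v \<in> E. \<not> adj v a} \<le> 8 * n div 1000000000" if "a \<in> V1" for a
    proof -
      have "card {v \<in> E. \<not> adj v a} \<le> card {w \<in> V2. \<not> adj a w}"
        using fin by (intro card_mono) (auto simp: E_def intro: adj_sym)
      then show ?thesis using miss1[OF that] by simp
    qed
  qed (use fin finE in auto)
  moreover have "card E * n \<le> 2000 * (card E * (n div 2000 + 1))"
  proof -
    have "n \<le> 2000 * (n div 2000 + 1)" using dividend_less_div_times[of 2000 n] by simp
    then have "card E * n \<le> card E * (2000 * (n div 2000 + 1))" by (rule mult_le_mono2)
    then show ?thesis by (simp add: algebra_simps)
  qed
  moreover have "card V1 * (8 * n div 1000000000) \<le> n * (8 * n div 1000000000)"
    using n_split by (intro mult_le_mono1) simp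
  ultimately have "card E * n \<le> 2000 * (n * (8 * n div 1000000000))" by linarith
  then have "card E * n \<le> (2000 * (8 * n div 1000000000)) * n" by (simp add: algebra_simps)
  then have "card E \<le> 2000 * (8 * n div 1000000000)" using n(2) by simp
  then have cE: "62500 * card E \<le> n" by linarith
  define L where "L = {v \<in> V2. 10 * card {a \<in> V1. adj v a} < n}"
  have "L \<subseteq> E"
  proof
    fix v assume "v \<in> L"
    then have v: "v \<in> V2" "10 * card {a \<in> V1. adj v a} < n" by (auto simp: L_def)
    then have "n < 2000 * card {a \<in> V1. \<not> adj v a}"
      using compl[OF fin(1), of v] size n(2) by linarith
    then show "v \<in> E" using v(1) by (simp add: E_def)
  qed
  then have cL: "62500 * card L \<le> n" using cE card_mono[OF finE, of L] by linarith
  have L: "L \<subseteq> V2" "finite L" using fin by (auto simp: L_def)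
  have minus_L: "card {w \<in> V2. P w} \<le> card {w \<in> V2 - L. P w} + card L" for P
    using card_restrict_le[OF fin(2) L(2), of P "\<lambda>_. True"] by simp
  have "rough_bipartite G (V1 \<union> L) (V2 - L) (pverts G - E) n"
  proof
    show "(V1 \<union> L) \<union> (V2 - L) = pverts G" "(V1 \<union> L) \<inter> (V2 - L) = {}" using V L by auto
    show "1500 * card {b \<in> V2 - L. \<not> adj a b} \<le> n" if "a \<in> V1 \<union> L" "a \<in> pverts G - E" for a
    proof -
      have "a \<in> V1" using that \<open>L \<subseteq> E\<close> by blast
      moreover have "card {b \<in> V2 - L. \<not> adj a b} \<le> card {b \<in> V2. \<not> adj a b}"
        using fin by (intro card_mono) auto
      ultimately show ?thesis using miss1[of a] by simp
    qed
    show "1500 * card {a \<in> V1 \<union> L. \<not> adj b a} \<le> n" if "b \<in> V2 - L" "b \<in> pverts G - E" for b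
    proof -
      have "card {a \<in> V1 \<union> L. \<not> adj b a} \<le> card ({a \<in> V1. \<not> adj b a} \<union> L)"
        using fin L by (intro card_mono) auto
      also have "\<dots> \<le> card {a \<in> V1. \<not> adj b a} + card L" by (rule card_Un_le)
      finally show ?thesis using that cL by (auto simp: E_def)
    qed
    have "card (pverts G - (pverts G - E)) \<le> card E" using finE by (intro card_mono) auto
    then show "10000 * card (pverts G - (pverts G - E)) \<le> n" using cE by linarith
    show "n \<le> 12 * card {b \<in> V2 - L. adj a b}" if "a \<in> V1 \<union> L" for a
    proof -
      have "10 * card {w \<in> V1. adj a w} \<le> n"
        using that sparse[of a] by (auto simp: L_def)
      moreover have "a \<in> pverts G" using that V L by blast
      ultimately show ?thesis using deg1[of a] minus_L[of "adj a"] cL by linarith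
    qed
    show "n \<le> 12 * card {a \<in> V1 \<union> L. adj b a}" if "b \<in> V2 - L" for b
    proof -
      have "card {a \<in> V1. adj b a} \<le> card {a \<in> V1 \<union> L. adj b a}"
        using fin L by (intro card_mono) auto
      moreover have "n \<le> 10 * card {a \<in> V1. adj b a}" using that by (auto simp: L_def)
      ultimately show ?thesis by linarith
    qed
    have "V1 \<inter> L = {}" using L V by blast
    then have cards: "card (V1 \<union> L) = card V1 + card L" "card (V2 - L) + card L = card V2"
      using fin L card_mono[OF fin(2) L(1)] by (auto simp: card_Un_disjoint card_Diff_subset)
    show "10000 * card (V1 \<union> L) \<le> 10000 * card (V2 - L) + n"
      "10000 * card (V2 - L) \<le> 10000 * card (V1 \<union> L) + n"
      using cards cL size size2 n_split by linarith+
  qed (use n min_deg in auto)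
  then show ?thesis by blast
qed

lemma out_degree_card: "out_degree (with_proj G) v = card {w \<in> pverts G. adj v w}"
proof -
  have "out_arcs (with_proj G) v = Pair v ` {w \<in> pverts G. adj v w}"
    using in_arcsD2 by (auto simp: out_arcs_def)
  then show ?thesis by (simp add: out_degree_def card_image inj_on_def)
qed

end

theorem theorem3p2:
  shows "\<exists>\<beta>0::real. 0 < \<beta>0 \<and> \<beta>0 \<le> 1 / (20 * 17 ^ 3) \<and>
    (\<forall>\<beta>. 0 < \<beta> \<and> \<beta> < \<beta>0 \<longrightarrow>
      (\<exists>n0::nat. \<forall>n\<ge>n0. \<forall>G :: 'a pair_pre_digraph.
        pair_graph G \<and> card (pverts G) = n \<and>
        real (min_degree (with_proj G)) \<ge> (real n + 1) / 2 \<and>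
        (\<exists>V1 V2. V1 \<union> V2 = pverts G \<and> V1 \<inter> V2 = {} \<and>
          real (card V1) \<ge> (1 / 2 - 7 * \<beta>) * real n \<and>
          real (max_degree (with_proj G \<restriction> V1)) \<le> \<beta> * real n)
        \<longrightarrow> (\<exists>H. spanning (with_proj H) (with_proj G) \<and> halin_graph H)))"
proof (intro exI[of _ "1 / 1000000000 :: real"] conjI allI impI)
  \<comment> \<open>\<beta> is used only through the bound n/10^9 on \<beta> n; this value makes the
    set of exceptional vertices smaller than n/62500 up to equality, well within the n/10000
    allowed. From n = 10000 on, additive constants disappear in the linear slack.\<close>
  fix \<beta> :: real assume \<beta>: "0 < \<beta> \<and> \<beta> < 1 / 1000000000"
  show "\<exists>n0::nat. \<forall>n\<ge>n0. \<forall>G :: 'a pair_pre_digraph.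
        pair_graph G \<and> card (pverts G) = n \<and>
        real (min_degree (with_proj G)) \<ge> (real n + 1) / 2 \<and>
        (\<exists>V1 V2. V1 \<union> V2 = pverts G \<and> V1 \<inter> V2 = {} \<and>
          real (card V1) \<ge> (1 / 2 - 7 * \<beta>) * real n \<and>
          real (max_degree (with_proj G \<restriction> V1)) \<le> \<beta> * real n)
        \<longrightarrow> (\<exists>H. spanning (with_proj H) (with_proj G) \<and> halin_graph H)"
  proof (intro exI[of _ 10000] allI impI, elim conjE exE)
    fix n and G :: "'a pair_pre_digraph" and V1 V2
    assume n: "n \<ge> 10000" "card (pverts G) = n" and G: "pair_graph G"
      and deg: "real (min_degree (with_proj G)) \<ge> (real n + 1) / 2"
      and V: "V1 \<union> V2 = pverts G" "V1 \<inter> V2 = {}"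
      and V1: "real (card V1) \<ge> (1 / 2 - 7 * \<beta>) * real n"
      and sparse: "real (max_degree (with_proj G \<restriction> V1)) \<le> \<beta> * real n"
    interpret pair_graph G by (rule G)
    have fin: "finite V1" using V(1) pair_finite_verts by (metis finite_Un)
    have \<beta>n: "\<beta> * real n \<le> real n / 1000000000"
      using \<beta> mult_right_mono[of \<beta> "1 / 1000000000" "real n"] by simp
    have min_deg: "n + 1 \<le> 2 * card {w \<in> pverts G. (v, w) \<in> parcs G}" if "v \<in> pverts G" for v
    proof -
      have "min_degree (with_proj G) \<le> out_degree (with_proj G) v"
        unfolding min_degree_def using that pair_finite_verts by (intro Min_le) auto
      then have "(real n + 1) / 2 \<le> real (card {w \<in> pverts G. (v, w) \<in> parcs G})"
        using deg unfolding out_degree_card by linarith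
      then have "real (n + 1) \<le> real (2 * card {w \<in> pverts G. (v, w) \<in> parcs G})" by simp
      then show ?thesis unfolding of_nat_le_iff .
    qed
    have sparse': "1000000000 * card {w \<in> V1. (v, w) \<in> parcs G} \<le> n" if v: "v \<in> V1" for v
    proof -
      have "out_arcs (with_proj G \<restriction> V1) v = Pair v ` {w \<in> V1. (v, w) \<in> parcs G}"
        using v by (auto simp: out_arcs_def induce_subgraph_def)
      then have "out_degree (with_proj G \<restriction> V1) v = card {w \<in> V1. (v, w) \<in> parcs G}"
        by (simp add: out_degree_def card_image inj_on_def)
      moreover have "out_degree (with_proj G \<restriction> V1) v \<le> max_degree (with_proj G \<restriction> V1)"
        unfolding max_degree_def using v fin by (intro Max_ge) (auto simp: induce_subgraph_def)
      ultimately have "real (card {w \<in> V1. (v, w) \<in> parcs G}) \<le> real n / 1000000000"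
        using sparse \<beta>n by linarith
      then have "real (1000000000 * card {w \<in> V1. (v, w) \<in> parcs G}) \<le> real n" by simp
      then show ?thesis unfolding of_nat_le_iff .
    qed
    have "real (1000000000 * n) \<le> real (2000000000 * card V1 + 14 * n)"
      using V1 \<beta>n by (simp add: algebra_simps)
    then have "1000000000 * n \<le> 2000000000 * card V1 + 14 * n" unfolding of_nat_le_iff .
    then obtain A B D where "rough_bipartite G A B D n"
      using rough_bipartite_exists[OF V n(2,1) min_deg sparse'] by blast
    then have spanning_halin_exists by (rule rough_bipartite.spanning_halin)
    then show "\<exists>H. spanning (with_proj H) (with_proj G) \<and> halin_graph H"
      unfolding spanning_halin_exists_def .
  qed
qed auto

end
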